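(* Let $1\le m\le n$ and $s,t\ge 0$ be integers, and let $\mathsf{k}$ be a field with $\operatorname{char}\mathsf{k}=0$ or $\operatorname{char}\mathsf{k}>(m-1)+(n-1)$. Let $\mathsf{m}_s$ denote a string of length $m$ beginning in degree $s$ and $\mathsf{n}_t$ a string of length $n$ beginning in degree $t$. Then the Jordan degree type of their tensor product is $$\mathsf{m}_s\otimes_{\mathsf{k}}\mathsf{n}_t=\bigl((\mathsf{n}+\mathsf{m}-1)_{s+t},\,(\mathsf{n}+\mathsf{m}-3)_{s+t+1},\,\ldots,\,(\mathsf{n}-\mathsf{m}+1)_{s+t+m-1}\bigr)=\bigoplus_{k=1}^{m}(\mathsf{n}+\mathsf{m}+1-2k)_{s+t+k-1}.$$
   Context: A string $\mathsf{m}_s$ of length $m$ beginning in degree $s$ is the graded vector space with basis $z,\ell z,\dots,\ell^{m-1}z$, where $\ell^iz$ has degree $s+i$, with the degree-one nilpotent operator $\ell$ satisfying $\ell^mz=0$; i.e. the cyclic graded $\mathsf{k}[\ell]$-module $\mathsf{k}[\ell]/(\ell^m)$ with generator placed in degree $s$. On the tensor product $\mathsf{m}_s\otimes_{\mathsf{k}}\mathsf{n}_t$ of a string for $\ell_1$ and a string for $\ell_2$, graded by total degree, the operator is $\ell=\ell_1\otimes1+1\otimes\ell_2$. Jordan degree type: a finite-dimensional graded vector space with degree-one nilpotent operator $\ell$ is a direct sum of (homogeneous) strings; its Jordan degree type is the multiset of these strings recorded as pairs (length, initial degree), a string of length $p$ beginning in degree $\nu$ being written $\mathsf{p}_\nu$;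 it does not depend on the decomposition. In the display, $(\mathsf{n}+\mathsf{m}+1-2k)_{s+t+k-1}$ is a string of length $n+m+1-2k$ beginning in degree $s+t+k-1$. *)

theory Defs
  imports
    Complex_Main
    "HOL-Library.Poly_Mapping"
    "HOL-Library.Multiset"
begin

section \<open>Graded vector spaces with a degree-one nilpotent operator\<close>

text \<open>
  A vector space is a subspace \<open>V\<close> of an ambient space in the sense of the locale
  \<^locale>\<open>vector_space\<close>, so that its dimension is not tied to a type.  Only the values
  on \<open>V\<close> of an operator on \<open>V\<close> matter.
\<close>

text \<open>Internal direct sum \<open>V = (\<Oplus>i\<in>I. U i)\<close>.\<close>

definition direct_sum ::
    "('k::field \<Rightarrow> 'v::ab_group_add \<Rightarrow> 'v) \<Rightarrow> 'i set \<Rightarrow> ('i \<Rightarrow> 'v set) \<Rightarrow> 'v set \<Rightarrow> bool" where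
  "direct_sum sc I U V \<longleftrightarrow>
     (\<forall>i\<in>I. module.subspace sc (U i)) \<and>
     V = module.span sc (\<Union>i\<in>I. U i) \<and>
     (\<forall>J c. finite J \<and> J \<subseteq> I \<and> (\<forall>i\<in>J. c i \<in> U i) \<and> sum c J = 0 \<longrightarrow> (\<forall>i\<in>J. c i = 0))"

definition linear_on ::
    "('k::field \<Rightarrow> 'v::ab_group_add \<Rightarrow> 'v) \<Rightarrow> 'v set \<Rightarrow> ('v \<Rightarrow> 'v) \<Rightarrow> bool" where
  "linear_on sc V l \<longleftrightarrow>
     (\<forall>x\<in>V. \<forall>y\<in>V. l (x + y) = l x + l y) \<and> (\<forall>a. \<forall>x\<in>V. l (sc a x) = sc a (l x))"

definition graded_nilpotent ::
    "('k::field \<Rightarrow> 'v::ab_group_add \<Rightarrow> 'v) \<Rightarrow> 'v set \<Rightarrow> (nat \<Rightarrow> 'v set) \<Rightarrow> ('v \<Rightarrow> 'v) \<Rightarrow> bool"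
    where
  "graded_nilpotent sc V gr l \<longleftrightarrow>
     (\<exists>B. finite B \<and> V = module.span sc B) \<and>
     direct_sum sc UNIV gr V \<and>
     linear_on sc V l \<and>
     (\<forall>d. l ` gr d \<subseteq> gr (Suc d)) \<and>
     (\<exists>N. \<forall>x\<in>V. (l ^^ N) x = 0)"

text \<open>A string is nonzero (\<open>1 \<le> m\<close>), so no zero summands occur in a decomposition.\<close>

definition is_string ::
    "('k::field \<Rightarrow> 'v::ab_group_add \<Rightarrow> 'v) \<Rightarrow> 'v set \<Rightarrow> (nat \<Rightarrow> 'v set) \<Rightarrow> ('v \<Rightarrow> 'v) \<Rightarrow>
     nat \<Rightarrow> nat \<Rightarrow> bool" where
  "is_string sc V gr l m s \<longleftrightarrow>
     graded_nilpotent sc V gr l \<and> 1 \<le> m \<and>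
     (\<exists>z \<in> gr s.
        inj_on (\<lambda>i. (l ^^ i) z) {..<m} \<and>
        \<not> module.dependent sc ((\<lambda>i. (l ^^ i) z) ` {..<m}) \<and>
        module.span sc ((\<lambda>i. (l ^^ i) z) ` {..<m}) = V \<and>
        (l ^^ m) z = 0)"

text \<open>
  Each summand \<open>U i\<close> is homogeneous: it is graded by its intersections with the graded
  pieces of \<open>V\<close>.  The pairs in \<open>M\<close> are (length, initial degree).
\<close>

definition string_decomposition ::
    "('k::field \<Rightarrow> 'v::ab_group_add \<Rightarrow> 'v) \<Rightarrow> 'v set \<Rightarrow> (nat \<Rightarrow> 'v set) \<Rightarrow> ('v \<Rightarrow> 'v) \<Rightarrow>
     (nat \<times> nat) multiset \<Rightarrow> bool" where
  "string_decomposition sc V gr l M \<longleftrightarrow>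
     graded_nilpotent sc V gr l \<and>
     (\<exists>ps U. mset ps = M \<and>
        direct_sum sc {..<length ps} U V \<and>
        (\<forall>i<length ps. is_string sc (U i) (\<lambda>d. U i \<inter> gr d) l (fst (ps ! i)) (snd (ps ! i))))"

definition jordan_degree_type ::
    "('k::field \<Rightarrow> 'v::ab_group_add \<Rightarrow> 'v) \<Rightarrow> 'v set \<Rightarrow> (nat \<Rightarrow> 'v set) \<Rightarrow> ('v \<Rightarrow> 'v) \<Rightarrow>
     (nat \<times> nat) multiset" where
  "jordan_degree_type sc V gr l = (THE M. string_decomposition sc V gr l M)"

section \<open>Tensor products\<close>

text \<open>The free vector space on \<open>'x\<close> is the type of finitely supported functions.\<close>

definition free_scale :: "'k::field \<Rightarrow> ('x \<Rightarrow>\<^sub>0 'k) \<Rightarrow> ('x \<Rightarrow>\<^sub>0 'k)" where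
  "free_scale a = Poly_Mapping.map ((*) a)"

lemma lookup_free_scale: "Poly_Mapping.lookup (free_scale a f) x = a * Poly_Mapping.lookup f x"
  unfolding free_scale_def by (simp add: Poly_Mapping.map.rep_eq when_def)

interpretation free: vector_space "free_scale :: 'k::field \<Rightarrow> ('x \<Rightarrow>\<^sub>0 'k) \<Rightarrow> ('x \<Rightarrow>\<^sub>0 'k)"
  by unfold_locales
    (auto intro!: poly_mapping_eqI simp: lookup_free_scale Poly_Mapping.lookup_add algebra_simps)

definition tensor_relations ::
    "('k::field \<Rightarrow> 'v::ab_group_add \<Rightarrow> 'v) \<Rightarrow> 'v set \<Rightarrow>
     ('k \<Rightarrow> 'w::ab_group_add \<Rightarrow> 'w) \<Rightarrow> 'w set \<Rightarrow> (('v \<times> 'w) \<Rightarrow>\<^sub>0 'k) set" where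
  "tensor_relations sV V sW W =
     (let e = (\<lambda>v w. Poly_Mapping.single (v, w) 1) in
        {e (v + v') w - e v w - e v' w | v v' w. v \<in> V \<and> v' \<in> V \<and> w \<in> W} \<union>
        {e v (w + w') - e v w - e v w' | v w w'. v \<in> V \<and> w \<in> W \<and> w' \<in> W} \<union>
        {e (sV a v) w - free_scale a (e v w) | a v w. v \<in> V \<and> w \<in> W} \<union>
        {e v (sW a w) - free_scale a (e v w) | a v w. v \<in> V \<and> w \<in> W})"

definition free_eval ::
    "('k::field \<Rightarrow> 'u::ab_group_add \<Rightarrow> 'u) \<Rightarrow> ('x \<Rightarrow> 'u) \<Rightarrow> ('x \<Rightarrow>\<^sub>0 'k) \<Rightarrow> 'u" where
  "free_eval sT g f = (\<Sum>x\<in>Poly_Mapping.keys f. sT (Poly_Mapping.lookup f x) (g x))"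

text \<open>
  The space \<open>T\<close> together with \<open>\<tau>\<close>, where \<open>\<tau> v w\<close> stands for \<open>v \<otimes> w\<close>, is a tensor product of
  \<open>V\<close> and \<open>W\<close>: the linear map from the free vector space on \<open>V \<times> W\<close> given by \<open>\<tau>\<close> is onto
  \<open>T\<close> and its kernel is the span of the bilinearity relations, that is, \<open>\<tau>\<close> identifies
  \<open>T\<close> with the usual quotient.
\<close>

definition is_tensor_product ::
    "('k::field \<Rightarrow> 'v::ab_group_add \<Rightarrow> 'v) \<Rightarrow> 'v set \<Rightarrow>
     ('k \<Rightarrow> 'w::ab_group_add \<Rightarrow> 'w) \<Rightarrow> 'w set \<Rightarrow>
     ('k \<Rightarrow> 'u::ab_group_add \<Rightarrow> 'u) \<Rightarrow> 'u set \<Rightarrow> ('v \<Rightarrow> 'w \<Rightarrow> 'u) \<Rightarrow> bool" where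
  "is_tensor_product sV V sW W sT T \<tau> \<longleftrightarrow>
     (let F = {f. Poly_Mapping.keys f \<subseteq> V \<times> W}; ev = free_eval sT (\<lambda>(v, w). \<tau> v w) in
        ev ` F = T \<and> {f \<in> F. ev f = 0} = module.span free_scale (tensor_relations sV V sW W))"

definition tensor_grading ::
    "('k::field \<Rightarrow> 'u::ab_group_add \<Rightarrow> 'u) \<Rightarrow> ('v \<Rightarrow> 'w \<Rightarrow> 'u) \<Rightarrow>
     (nat \<Rightarrow> 'v set) \<Rightarrow> (nat \<Rightarrow> 'w set) \<Rightarrow> nat \<Rightarrow> 'u set" where
  "tensor_grading sT \<tau> grV grW d =
     module.span sT {\<tau> v w | v w i j. v \<in> grV i \<and> w \<in> grW j \<and> i + j = d}"

text \<open>\<open>L = l1 \<otimes> 1 + 1 \<otimes> l2\<close> on \<open>T\<close>; the pure tensors span \<open>T\<close>, so this determines \<open>L\<close> there.\<close>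

definition is_tensor_operator ::
    "('k::field \<Rightarrow> 'u::ab_group_add \<Rightarrow> 'u) \<Rightarrow> 'v set \<Rightarrow> 'w set \<Rightarrow> 'u set \<Rightarrow> ('v \<Rightarrow> 'w \<Rightarrow> 'u) \<Rightarrow>
     ('v \<Rightarrow> 'v) \<Rightarrow> ('w \<Rightarrow> 'w) \<Rightarrow> ('u \<Rightarrow> 'u) \<Rightarrow> bool" where
  "is_tensor_operator sT V W T \<tau> l1 l2 L \<longleftrightarrow>
     linear_on sT T L \<and>
     (\<forall>v\<in>V. \<forall>w\<in>W. L (\<tau> v w) = \<tau> (l1 v) w + \<tau> v (l2 w))"

subsection \<open>Existence\<close>

lemma free_eval_via_linear:
  fixes P :: "('x \<Rightarrow>\<^sub>0 'k::field) \<Rightarrow> 'u::ab_group_add"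
  assumes "Vector_Spaces.linear free_scale sT P"
  shows "free_eval sT (\<lambda>x. P (Poly_Mapping.single x 1)) f = P f"
proof -
  interpret P: Vector_Spaces.linear free_scale sT P by (rule assms)
  have "f = (\<Sum>x\<in>Poly_Mapping.keys f.
      free_scale (Poly_Mapping.lookup f x) (Poly_Mapping.single x 1))"
    by (rule poly_mapping_eqI)
      (auto simp: Poly_Mapping.lookup_sum lookup_free_scale Poly_Mapping.lookup_single when_def
            Poly_Mapping.in_keys_iff
            if_distrib[of "\<lambda>z. _ * z"] cong: if_cong)
  then have "P f = P (\<Sum>x\<in>Poly_Mapping.keys f.
      free_scale (Poly_Mapping.lookup f x) (Poly_Mapping.single x 1))"
    by simp
  also have "\<dots> = free_eval sT (\<lambda>x. P (Poly_Mapping.single x 1)) f"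
    unfolding free_eval_def P.sum P.scale ..
  finally show ?thesis ..
qed

lemma tensor_relations_support:
  assumes "vector_space sV" "vector_space sW"
    and "module.subspace sV V" "module.subspace sW W"
  shows "free.span (tensor_relations sV V sW W) \<subseteq> {f. Poly_Mapping.keys f \<subseteq> V \<times> W}"
proof (rule free.span_minimal)
  interpret V: vector_space sV by fact
  interpret W: vector_space sW by fact
  show sub: "free.subspace {f. Poly_Mapping.keys f \<subseteq> V \<times> W}"
    unfolding free.subspace_def
    by (auto simp: lookup_free_scale Poly_Mapping.in_keys_iff dest!: set_mp[OF Poly_Mapping.keys_add])
  have e: "Poly_Mapping.single (v, w) (1::'a) \<in> {f. Poly_Mapping.keys f \<subseteq> V \<times> W}"
    if "v \<in> V" "w \<in> W" for v w using that by simp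
  show "tensor_relations sV V sW W \<subseteq> {f. Poly_Mapping.keys f \<subseteq> V \<times> W}"
    unfolding tensor_relations_def Let_def
    by (intro Un_least subsetI; elim CollectE exE conjE; hypsubst)
      (intro free.subspace_diff[OF sub] free.subspace_scale[OF sub] e
          V.subspace_add[OF assms(3)] W.subspace_add[OF assms(4)]
          V.subspace_scale[OF assms(3)] W.subspace_scale[OF assms(4)]; assumption)+
qed

lemma tensor_product_exists:
  fixes sV :: "'k::field \<Rightarrow> 'v::ab_group_add \<Rightarrow> 'v" and sW :: "'k \<Rightarrow> 'w::ab_group_add \<Rightarrow> 'w"
  assumes "vector_space sV" "vector_space sW"
    and "module.subspace sV V" "module.subspace sW W"
  shows "\<exists>(T :: (('v \<times> 'w) \<Rightarrow>\<^sub>0 'k) set) \<tau>. is_tensor_product sV V sW W free_scale T \<tau>"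
proof -
  let ?R = "tensor_relations sV V sW W" and ?F = "{f. Poly_Mapping.keys f \<subseteq> V \<times> W}"
  interpret FF: vector_space_pair "free_scale :: 'k \<Rightarrow> (('v \<times> 'w) \<Rightarrow>\<^sub>0 'k) \<Rightarrow> _"
      "free_scale :: 'k \<Rightarrow> (('v \<times> 'w) \<Rightarrow>\<^sub>0 'k) \<Rightarrow> _" ..
  obtain B where B: "free.independent B" "free.span B = free.span ?R"
    using free.maximal_independent_subset[of "free.span ?R"]
    by (metis free.span_eq free.span_span subset_antisym free.span_minimal free.subspace_span)
  define Q where "Q = FF.construct B (\<lambda>b. b)"
  define P where "P = (\<lambda>f. f - Q f)"
  have linQ: "Vector_Spaces.linear free_scale free_scale Q"
    unfolding Q_def by (rule FF.linear_construct[OF B(1)])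
  have linP: "Vector_Spaces.linear free_scale free_scale P"
    unfolding P_def by (intro FF.linear_compose_sub linQ free.linear_ident)
  have Q_in: "Q f \<in> free.span B" for f
    unfolding Q_def using FF.construct_in_span[OF B(1), of "\<lambda>b. b" f] by simp
  have Q_id: "Q f = f" if "f \<in> free.span B" for f
    using FF.linear_eq_on[OF linQ free.linear_ident that]
    by (simp add: Q_def FF.construct_basis[OF B(1)])
  have ker: "P f = 0 \<longleftrightarrow> f \<in> free.span ?R" for f
    unfolding P_def B(2)[symmetric] using Q_in[of f] Q_id[of f] by auto
  define \<tau> where "\<tau> = (\<lambda>v w. P (Poly_Mapping.single (v, w) 1))"
  have ev: "free_eval free_scale (\<lambda>(v, w). \<tau> v w) f = P f" for f
    using free_eval_via_linear[OF linP, of f] by (simp add: \<tau>_def case_prod_unfold)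
  have "is_tensor_product sV V sW W free_scale (P ` ?F) \<tau>"
    unfolding is_tensor_product_def Let_def ev ker
    using tensor_relations_support[OF assms] by (auto simp: ev)
  then show ?thesis by blast
qed

end

theory Submission
  imports Defs
begin

text \<open>
  This is the Clebsch--Gordan rule for a pair of strings, proved with an \<open>sl\<^sub>2\<close>-type lowering
  operator.

  Let \<open>x\<close> and \<open>y\<close> generate the two strings.  The vectors \<open>e i j = \<tau> (l1\<^sup>i x) (l2\<^sup>j y)\<close> with \<open>i < m\<close> and
  \<open>j < n\<close> form a basis of \<open>T\<close>: they span by bilinearity, and they are independent because products
  of coordinate functionals of \<open>V\<close> and \<open>W\<close> vanish on the bilinearity relations.  The operator \<open>L\<close>
  sends \<open>e i j\<close> to \<open>e (i+1) j + e i (j+1)\<close>.  Let \<open>F\<close> send \<open>e i j\<close> to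
  \<open>i(m-i) e (i-1) j + j(n-j) e i (j-1)\<close>, the sum of the lowering operators of the two strings
  regarded as irreducible \<open>sl\<^sub>2\<close>-modules.  With \<open>N = (m-1) + (n-1)\<close>, the commutator \<open>FL - LF\<close> is the
  scalar \<open>N - 2d\<close> on the span of the \<open>e i j\<close> with \<open>i + j = d\<close>.

  For every \<open>a < m\<close> there is an explicit nonzero vector \<open>p\<close> in the span of the \<open>e i j\<close> with
  \<open>i + j = a\<close> that \<open>F\<close> kills, and the commutator relation gives
  \<open>F (L\<^sup>r\<^sup>+\<^sup>1 p) = (r+1)(N-2a-r) L\<^sup>r p\<close>.  For all \<open>r\<close> that matter,
  \<open>r = N - 2a\<close> apart, the factor is up to sign a product of two integers between \<open>1\<close> and \<open>N\<close>, which
  the hypothesis on the characteristic makes nonzero in the field.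

  This has two consequences.  The vectors \<open>L\<^sup>r p\<close> with \<open>r \<le> N - 2a\<close>, for all \<open>a\<close> together, are
  independent, because powers of \<open>F\<close> bring them back to multiples of the \<open>p\<close>
  (\<open>indep_ladders\<close>).  And \<open>L\<^sup>r p = 0\<close> for \<open>r = N - 2a + 1\<close>, because \<open>L\<^sup>r p\<close> vanishes for large \<open>r\<close>
  by degree and the relation carries this vanishing downwards (\<open>prim_string_ends\<close>).  The lengths
  \<open>N - 2a + 1\<close> add up to \<open>mn\<close>, so these strings exhaust \<open>T\<close>.

  The Jordan degree type is well defined because \<open>dim (L\<^sup>i (gr d))\<close> counts the strings that occupy
  both degree \<open>d\<close> and degree \<open>d + i\<close>, and these counts determine the multiset of strings
  (\<open>dim_image_graded_piece\<close>, \<open>string_multiset_eqI\<close>).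
\<close>

section \<open>Indexed families of vectors\<close>

text \<open>
  A copy of \<^locale>\<open>vector_space\<close>, kept apart so that the notions introduced here do not spread to
  the existing interpretations of that locale.
\<close>
locale families = vector_space
begin

text \<open>
  Independence as a property of the indexed family, not of the set of its values: strings are
  families \<open>i \<mapsto> l\<^sup>i z\<close>, and repetitions have to count as dependence.
\<close>
definition indep_family :: "'i set \<Rightarrow> ('i \<Rightarrow> 'b) \<Rightarrow> bool" where
  "indep_family I b \<longleftrightarrow> (\<forall>c. (\<Sum>i\<in>I. scale (c i) (b i)) = 0 \<longrightarrow> (\<forall>i\<in>I. c i = 0))"

lemma indep_familyD:
  assumes "indep_family I b" "(\<Sum>i\<in>I. scale (c i) (b i)) = 0" "i \<in> I"
  shows "c i = 0"
  using assms unfolding indep_family_def by blast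

lemma span_family:
  assumes "finite I"
  shows "span (b ` I) = range (\<lambda>c. \<Sum>i\<in>I. scale (c i) (b i))"
proof
  show "range (\<lambda>c. \<Sum>i\<in>I. scale (c i) (b i)) \<subseteq> span (b ` I)"
    by (auto intro!: span_sum span_scale intro: span_base)
  have "b i \<in> range (\<lambda>c. \<Sum>i\<in>I. scale (c i) (b i))" if "i \<in> I" for i
    by (rule range_eqI[of _ _ "\<lambda>j. if j = i then 1 else 0"])
      (use assms that in \<open>simp add: if_distrib[of "\<lambda>a. scale a _"] cong: if_cong\<close>)
  moreover have "subspace (range (\<lambda>c. \<Sum>i\<in>I. scale (c i) (b i)))"
  proof (rule subspaceI)
    show "0 \<in> range (\<lambda>c. \<Sum>i\<in>I. scale (c i) (b i))"
      by (rule range_eqI[of _ _ "\<lambda>_. 0"]) simp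
  next
    fix x y assume "x \<in> range (\<lambda>c. \<Sum>i\<in>I. scale (c i) (b i))"
      "y \<in> range (\<lambda>c. \<Sum>i\<in>I. scale (c i) (b i))"
    then obtain c d where "x = (\<Sum>i\<in>I. scale (c i) (b i))" "y = (\<Sum>i\<in>I. scale (d i) (b i))"
      by auto
    then show "x + y \<in> range (\<lambda>c. \<Sum>i\<in>I. scale (c i) (b i))"
      by (intro range_eqI[of _ _ "\<lambda>i. c i + d i"]) (simp add: scale_left_distrib sum.distrib)
  next
    fix a x assume "x \<in> range (\<lambda>c. \<Sum>i\<in>I. scale (c i) (b i))"
    then obtain c where "x = (\<Sum>i\<in>I. scale (c i) (b i))" by auto
    then show "scale a x \<in> range (\<lambda>c. \<Sum>i\<in>I. scale (c i) (b i))"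
      by (intro range_eqI[of _ _ "\<lambda>i. a * c i"]) (simp add: scale_sum_right)
  qed
  ultimately show "span (b ` I) \<subseteq> range (\<lambda>c. \<Sum>i\<in>I. scale (c i) (b i))"
    by (intro span_minimal) auto
qed

lemma span_familyE:
  assumes "finite I" "x \<in> span (b ` I)"
  obtains c where "x = (\<Sum>i\<in>I. scale (c i) (b i))"
  using assms span_family[of I b] by auto

lemma indep_family_iff:
  assumes "finite I"
  shows "indep_family I b \<longleftrightarrow> inj_on b I \<and> independent (b ` I)"
proof (intro iffI conjI)
  assume ind: "indep_family I b"
  show inj: "inj_on b I"
  proof (rule inj_onI, rule ccontr)
    fix i j assume ij: "i \<in> I" "j \<in> I" "b i = b j" "i \<noteq> j"
    let ?c = "\<lambda>k. (if k = i then 1 else 0) - (if k = j then 1 else 0)"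
    have "(\<Sum>k\<in>I. scale (?c k) (b k)) = b i - b j"
      using assms ij(1,2) 
      by (simp add: scale_left_diff_distrib sum_subtractf if_distrib[of "\<lambda>a. scale a _"] cong: if_cong)
    then have "(\<Sum>k\<in>I. scale (?c k) (b k)) = 0" using ij(3) by simp
    from indep_familyD[OF ind this ij(1)] show False using ij(4) by simp
  qed
  show "independent (b ` I)"
  proof
    assume "dependent (b ` I)"
    then obtain u i where u: "(\<Sum>v\<in>b ` I. scale (u v) v) = 0" "i \<in> I" "u (b i) \<noteq> 0"
      using assms by (auto simp: dependent_finite)
    have "(\<Sum>i\<in>I. scale (u (b i)) (b i)) = 0" using u(1) inj by (simp add: sum.reindex)
    from indep_familyD[OF ind this u(2)] u(3) show False by simp
  qed
next
  assume *: "inj_on b I \<and> independent (b ` I)"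
  show "indep_family I b" unfolding indep_family_def
  proof (intro allI impI ballI)
    fix c i assume c: "(\<Sum>i\<in>I. scale (c i) (b i)) = 0" and i: "i \<in> I"
    have "(\<Sum>v\<in>b ` I. scale (c (the_inv_into I b v)) v) = 0"
      using * c by (simp add: sum.reindex the_inv_into_f_f cong: sum.cong)
    from independentD[OF conjunct2[OF *] _ _ this, of "b i"] show "c i = 0"
      using assms i * by (simp add: the_inv_into_f_f)
  qed
qed

lemma indep_family_mono:
  assumes "indep_family I b" "J \<subseteq> I" "finite I"
  shows "indep_family J b"
  using assms by (meson finite_subset image_mono indep_family_iff independent_mono inj_on_subset)

lemma indep_family_reindex:
  assumes "indep_family I b" "inj_on f J" "f ` J = I"
  shows "indep_family J (\<lambda>j. b (f j))"
  unfolding indep_family_def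
proof (intro allI impI ballI)
  fix c j assume c: "(\<Sum>j\<in>J. scale (c j) (b (f j))) = 0" and j: "j \<in> J"
  have "(\<Sum>i\<in>I. scale (c (the_inv_into J f i)) (b i)) = 0"
    using assms(2,3) c by (auto simp: sum.reindex the_inv_into_f_f cong: sum.cong)
  from indep_familyD[OF assms(1) this, of "f j"] show "c j = 0"
    using assms j by (auto simp: the_inv_into_f_f)
qed

lemma dim_span_family:
  assumes "finite I" "indep_family I b"
  shows "dim (span (b ` I)) = card I"
  using assms by (simp add: indep_family_iff dim_eq_card_independent card_image)

text \<open>
  The ambient space need not be finite-dimensional, so this comes from the Steinitz bound:
  a vector of \<open>E\<close> outside the span of \<open>S\<close> could be added to \<open>S\<close>, which would then have too many elements.
\<close>
lemma span_eq_of_card: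
  assumes "finite E" "independent S" "S \<subseteq> span E" "card S = card E"
  shows "span S = span E"
proof
  show "span S \<subseteq> span E" using assms(3) by (simp add: span_minimal)
  have "E \<subseteq> span S"
  proof (rule ccontr)
    assume "\<not> E \<subseteq> span S"
    then obtain x where x: "x \<in> E" "x \<notin> span S" by blast
    have "independent (insert x S)" using x(2) assms(2) by (rule independent_insertI)
    moreover have "insert x S \<subseteq> span E" using assms(3) x(1) by (auto intro: span_base)
    ultimately have "finite (insert x S) \<and> card (insert x S) \<le> card E"
      by (rule independent_span_bound[OF assms(1)])
    moreover have "x \<notin> S" using x(2) span_base[of x S] by metis
    moreover have "finite S" using assms(2,3) independent_span_bound[OF assms(1)] by blast
    ultimately show False using assms(4) by simp
  qed
  then show "span E \<subseteq> span S" by (simp add: span_minimal)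
qed

section \<open>Direct sums and homogeneous bases\<close>

lemma direct_sum_subspace: "direct_sum scale I U V \<Longrightarrow> i \<in> I \<Longrightarrow> subspace (U i)"
  by (simp add: direct_sum_def)

lemma direct_sum_span: "direct_sum scale I U V \<Longrightarrow> V = span (\<Union>i\<in>I. U i)"
  by (simp add: direct_sum_def)

lemma direct_sum_subset: "direct_sum scale I U V \<Longrightarrow> i \<in> I \<Longrightarrow> U i \<subseteq> V"
  unfolding direct_sum_span[of I U V] by (auto intro: span_base)

lemma direct_sum_zeroD:
  assumes "direct_sum scale I U V" "finite J" "J \<subseteq> I" "\<And>i. i \<in> J \<Longrightarrow> c i \<in> U i" "sum c J = 0" "i \<in> J"
  shows "c i = 0"
  using assms unfolding direct_sum_def by blast

lemma direct_sum_of_indep_family: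
  assumes fin: "finite I" and ind: "indep_family I b" and g: "g ` I \<subseteq> D"
  shows "direct_sum scale D (\<lambda>d. span (b ` {i\<in>I. g i = d})) (span (b ` I))"
  unfolding direct_sum_def
proof (intro conjI allI impI)
  show "\<forall>d\<in>D. subspace (span (b ` {i\<in>I. g i = d}))" by simp
  show "span (b ` I) = span (\<Union>d\<in>D. span (b ` {i\<in>I. g i = d}))"
  proof
    show "span (b ` I) \<subseteq> span (\<Union>d\<in>D. span (b ` {i\<in>I. g i = d}))"
    proof (rule span_mono, clarify)
      fix i assume "i \<in> I"
      then show "b i \<in> (\<Union>d\<in>D. span (b ` {i\<in>I. g i = d}))"
        using g by (intro UN_I[of "g i"] span_base) auto
    qed
    have "span (b ` {i\<in>I. g i = d}) \<subseteq> span (b ` I)" for d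
      by (intro span_mono) auto
    then show "span (\<Union>d\<in>D. span (b ` {i\<in>I. g i = d})) \<subseteq> span (b ` I)"
      by (intro span_minimal) auto
  qed
  fix J c
  assume *: "finite J \<and> J \<subseteq> D \<and> (\<forall>d\<in>J. c d \<in> span (b ` {i\<in>I. g i = d})) \<and> sum c J = 0"
  have "\<exists>a. c d = (\<Sum>i\<in>{i\<in>I. g i = d}. scale (a i) (b i))" if "d \<in> J" for d
  proof -
    have "c d \<in> span (b ` {i\<in>I. g i = d})" using * that by blast
    moreover have "finite {i\<in>I. g i = d}" using fin by simp
    ultimately show ?thesis using span_family[of "{i\<in>I. g i = d}" b] by auto
  qed
  then obtain a where a: "\<And>d. d \<in> J \<Longrightarrow> c d = (\<Sum>i\<in>{i\<in>I. g i = d}. scale (a d i) (b i))"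
    by metis
  have "(\<Sum>i\<in>I. scale (if g i \<in> J then a (g i) i else 0) (b i)) =
      (\<Sum>i\<in>{i\<in>I. g i \<in> J}. scale (a (g i) i) (b i))"
    using fin by (intro sum.mono_neutral_cong_right) auto
  also have "\<dots> = (\<Sum>d\<in>J. \<Sum>i\<in>{i\<in>{i\<in>I. g i \<in> J}. g i = d}. scale (a (g i) i) (b i))"
    using fin * by (intro sum.group[symmetric]) auto
  also have "\<dots> = (\<Sum>d\<in>J. c d)"
    by (rule sum.cong[OF refl], subst a) (auto intro!: sum.cong)
  finally have 0: "(\<Sum>i\<in>I. scale (if g i \<in> J then a (g i) i else 0) (b i)) = 0"
    using * by simp
  show "\<forall>d\<in>J. c d = 0"
  proof
    fix d assume d: "d \<in> J"
    have "a d i = 0" if "i \<in> I" "g i = d" for i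
      using indep_familyD[OF ind 0 that(1)] that(2) d by simp
    then show "c d = 0" using a[OF d] by (simp add: sum.neutral)
  qed
qed

text \<open>
  A homogeneous spanning family splits by degree: sort an expansion of \<open>x\<close> by degree; directness
  of the grading leaves only the part in the degree of \<open>x\<close>.
\<close>
lemma graded_piece_eq_span:
  assumes gr: "direct_sum scale D gr V" and fin: "finite I"
    and V: "V = span (b ` I)" and hom: "\<And>i. i \<in> I \<Longrightarrow> g i \<in> D \<and> b i \<in> gr (g i)"
    and d: "d \<in> D"
  shows "gr d = span (b ` {i\<in>I. g i = d})"
proof
  have sub: "subspace (gr e)" if "e \<in> D" for e using gr that by (rule direct_sum_subspace)
  show "span (b ` {i\<in>I. g i = d}) \<subseteq> gr d"
    using hom sub[OF d] by (intro span_minimal) auto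
  show "gr d \<subseteq> span (b ` {i\<in>I. g i = d})"
  proof
    fix x assume x: "x \<in> gr d"
    then have "x \<in> span (b ` I)" using direct_sum_subset[OF gr d] V by auto
    then obtain a where a: "x = (\<Sum>i\<in>I. scale (a i) (b i))" by (rule span_familyE[OF fin])
    define h where "h e = (\<Sum>i\<in>{i\<in>I. g i = e}. scale (a i) (b i))" for e
    have h: "h e \<in> gr e" if "e \<in> D" for e
      unfolding h_def using hom sub[OF that]
      by (intro subspace_sum subspace_scale) auto
    define J where "J = insert d (g ` I)"
    have J: "finite J" "J \<subseteq> D" "d \<in> J" using fin hom d by (auto simp: J_def)
    have "x = (\<Sum>e\<in>J. h e)" unfolding a h_def
      using fin J(1) by (intro sum.group[symmetric]) (auto simp: J_def)
    moreover have "(\<Sum>e\<in>J. if e = d then x else 0) = x" using J by simp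
    ultimately have "(\<Sum>e\<in>J. h e - (if e = d then x else 0)) = 0" by (simp add: sum_subtractf)
    then have "h d - (if d = d then x else 0) = 0"
      by (rule direct_sum_zeroD[OF gr J(1,2), rotated]) 
        (use x h J sub in \<open>auto intro!: subspace_diff subspace_0\<close>)
    then have "x = h d" by simp
    also have "h d \<in> span (b ` {i\<in>I. g i = d})"
      unfolding h_def by (intro span_sum span_scale span_base) auto
    finally show "x \<in> span (b ` {i\<in>I. g i = d})" .
  qed
qed

lemma indep_family_Sigma:
  assumes ds: "direct_sum scale J U V" and fin: "finite J" "\<And>j. j \<in> J \<Longrightarrow> finite (I j)"
    and ind: "\<And>j. j \<in> J \<Longrightarrow> indep_family (I j) (b j)"
    and sp: "\<And>j. j \<in> J \<Longrightarrow> span (b j ` I j) = U j"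
  shows "indep_family (Sigma J I) (\<lambda>(j, i). b j i)"
    and "span ((\<lambda>(j, i). b j i) ` Sigma J I) = V"
proof -
  show "indep_family (Sigma J I) (\<lambda>(j, i). b j i)" unfolding indep_family_def
  proof (intro allI impI ballI)
    fix c p assume 0: "(\<Sum>p\<in>Sigma J I. scale (c p) (case p of (j, i) \<Rightarrow> b j i)) = 0" and "p \<in> Sigma J I"
    then obtain j i where p: "p = (j, i)" "j \<in> J" "i \<in> I j" by auto
    have "(\<Sum>j\<in>J. \<Sum>i\<in>I j. scale (c (j, i)) (b j i)) = 0"
      using 0 fin by (subst sum.Sigma) (auto simp: case_prod_unfold)
    then have "(\<Sum>i\<in>I j. scale (c (j, i)) (b j i)) = 0"
      by (rule direct_sum_zeroD[OF ds fin(1) subset_refl, rotated])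
        (use p sp in \<open>auto intro!: span_sum span_scale intro: span_base simp flip: sp\<close>)
    from indep_familyD[OF ind[OF p(2)] this p(3)] show "c p = 0" by (simp add: p)
  qed
  have "V = span (\<Union>j\<in>J. span (b j ` I j))" using direct_sum_span[OF ds] sp by simp
  also have "\<dots> = span ((\<lambda>(j, i). b j i) ` Sigma J I)"
  proof
    have "span (b j ` I j) \<subseteq> span ((\<lambda>(j, i). b j i) ` Sigma J I)" if "j \<in> J" for j
      using that by (intro span_mono) force
    then show "span (\<Union>j\<in>J. span (b j ` I j)) \<subseteq> span ((\<lambda>(j, i). b j i) ` Sigma J I)"
      by (intro span_minimal) auto
    show "span ((\<lambda>(j, i). b j i) ` Sigma J I) \<subseteq> span (\<Union>j\<in>J. span (b j ` I j))"
      by (intro span_mono) (auto intro: span_base)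
  qed
  finally show "span ((\<lambda>(j, i). b j i) ` Sigma J I) = V" ..
qed

section \<open>Linear operators on a subspace\<close>

lemma linear_on_sum:
  assumes "linear_on scale V l" "subspace V" "\<And>i. i \<in> I \<Longrightarrow> b i \<in> V"
  shows "l (\<Sum>i\<in>I. scale (c i) (b i)) = (\<Sum>i\<in>I. scale (c i) (l (b i)))"
proof -
  have add: "l (x + y) = l x + l y" if "x \<in> V" "y \<in> V" for x y
    using assms(1) that unfolding linear_on_def by blast
  have scale: "l (scale a x) = scale a (l x)" if "x \<in> V" for a x
    using assms(1) that unfolding linear_on_def by blast
  have "l 0 = 0" using scale[of 0 0] subspace_0[OF assms(2)] by simp
  moreover have "(\<Sum>i\<in>J. scale (c i) (b i)) \<in> V" if "J \<subseteq> I" for J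
    using assms(2,3) that by (intro subspace_sum subspace_scale) auto
  ultimately show ?thesis using assms(3)
    by (induction I rule: infinite_finite_induct)
      (simp_all add: add scale subspace_scale[OF assms(2)] subset_iff)
qed

lemma linear_on_zero:
  assumes "linear_on scale V l" "subspace V"
  shows "l 0 = 0"
  using linear_on_sum[OF assms, of "{}"] by simp

lemma linear_on_image_span:
  assumes "linear_on scale V l" "subspace V" "finite I" "b ` I \<subseteq> V"
  shows "l ` span (b ` I) = span ((\<lambda>i. l (b i)) ` I)"
proof -
  have "l (\<Sum>i\<in>I. scale (c i) (b i)) = (\<Sum>i\<in>I. scale (c i) (l (b i)))" for c
    using assms(4) by (intro linear_on_sum[OF assms(1,2)]) auto
  then show ?thesis
    using assms(3) by (simp add: span_family image_image)
qed

lemma linear_on_funpow: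
  assumes "linear_on scale V l" "l ` V \<subseteq> V"
  shows "linear_on scale V (l ^^ i) \<and> (l ^^ i) ` V \<subseteq> V"
  using assms by (induction i) (auto simp: linear_on_def image_subset_iff)

end

section \<open>Strings and homogeneous string bases\<close>

context families
begin

lemma graded_nilpotentD:
  assumes "graded_nilpotent scale V gr l"
  shows "direct_sum scale UNIV gr V" "linear_on scale V l" "subspace V" "l ` V \<subseteq> V" "l 0 = 0"
    and "\<And>x d. x \<in> gr d \<Longrightarrow> l x \<in> gr (Suc d)"
    and "\<And>d. gr d \<subseteq> V"
proof -
  show ds: "direct_sum scale UNIV gr V" and lin: "linear_on scale V l"
    and graded_step: "\<And>x d. x \<in> gr d \<Longrightarrow> l x \<in> gr (Suc d)"
    using assms by (auto simp: graded_nilpotent_def)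
  obtain B where B: "finite B" "V = span B" using assms by (auto simp: graded_nilpotent_def)
  show V: "subspace V" using B by simp
  show "l 0 = 0" using linear_on_zero[OF lin V] .
  show grV: "gr d \<subseteq> V" for d using direct_sum_subset[OF ds, of d] by simp
  show "l ` V \<subseteq> V"
  proof safe
    fix x assume "x \<in> V"
    then have "x \<in> span (\<Union>d. gr d)" using direct_sum_span[OF ds] by simp
    then have "x \<in> V \<and> l x \<in> V"
    proof (induction rule: span_induct_alt)
      case base
      then show ?case using linear_on_zero[OF lin V] subspace_0[OF V] by simp
    next
      case (step c x y)
      then obtain d where x: "x \<in> gr d" by blast
      have xV: "x \<in> V" "l x \<in> V"
        using subsetD[OF grV x] subsetD[OF grV graded_step[OF x]] .
      have "l (scale c x + y) = scale c (l x) + l y"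
        using lin xV(1) step(2) subspace_scale[OF V] unfolding linear_on_def by metis
      then show ?case using xV step(2) V by (simp add: subspace_add subspace_scale)
    qed
    then show "l x \<in> V" ..
  qed
qed

lemma orbit_homogeneous:
  assumes "graded_nilpotent scale V gr l" "z \<in> gr d"
  shows "(l ^^ i) z \<in> gr (d + i)"
  using assms(2) graded_nilpotentD(6)[OF assms(1)] by (induction i) auto

lemma funpow_zero:
  fixes l :: "'b \<Rightarrow> 'b"
  assumes "l 0 = 0"
  shows "(l ^^ i) 0 = 0"
  using assms by (induction i) auto

lemma orbit_vanishes:
  fixes l :: "'b \<Rightarrow> 'b"
  assumes "l 0 = 0" "(l ^^ p) z = 0" "p \<le> i"
  shows "(l ^^ i) z = 0"
proof -
  have "(l ^^ i) z = (l ^^ (i - p)) ((l ^^ p) z)"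
    using assms(3) funpow_add[of "i - p" p l] by simp
  then show ?thesis using assms(1,2) by (simp add: funpow_zero)
qed

lemma is_string_iff:
  "is_string scale V gr l m s \<longleftrightarrow> graded_nilpotent scale V gr l \<and> 1 \<le> m \<and>
    (\<exists>z \<in> gr s. indep_family {..<m} (\<lambda>i. (l ^^ i) z) \<and> span ((\<lambda>i. (l ^^ i) z) ` {..<m}) = V \<and>
      (l ^^ m) z = 0)"
  unfolding is_string_def by (auto simp: indep_family_iff)

text \<open>
  A homogeneous vector with independent iterates generates a homogeneous substring, since its
  iterates are themselves homogeneous.
\<close>
lemma is_string_span_orbit:
  assumes gn: "graded_nilpotent scale V gr l" and z: "z \<in> gr s" "(l ^^ m) z = 0" and m: "1 \<le> m"
    and ind: "indep_family {..<m} (\<lambda>i. (l ^^ i) z)"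
    and U: "U = span ((\<lambda>i. (l ^^ i) z) ` {..<m})"
  shows "is_string scale U (\<lambda>d. U \<inter> gr d) l m s"
proof -
  note V = graded_nilpotentD[OF gn]
  have hom: "(l ^^ i) z \<in> gr (s + i)" for i using orbit_homogeneous[OF gn z(1)] .
  have orbV: "(l ^^ i) z \<in> V" for i using V(7) hom by (rule subsetD)
  have UV: "U \<subseteq> V" unfolding U using V(3) orbV by (intro span_minimal) auto
  have "l ` U = span ((\<lambda>i. l ((l ^^ i) z)) ` {..<m})"
    unfolding U using orbV by (intro linear_on_image_span[OF V(2,3)]) auto
  also have "\<dots> \<subseteq> U"
  proof (rule span_minimal; clarify?)
    show "subspace U" by (simp add: U)
    fix i assume "i < m"
    show "l ((l ^^ i) z) \<in> U"
    proof (cases "Suc i < m")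
      case True
      then show ?thesis unfolding U by (intro span_base image_eqI[of _ _ "Suc i"]) auto
    next
      case False
      then have "m = Suc i" using \<open>i < m\<close> by simp
      then show ?thesis using z(2) by (simp add: U span_zero)
    qed
  qed
  finally have lU: "l ` U \<subseteq> U" .
  have "direct_sum scale UNIV (\<lambda>d. U \<inter> gr d) U"
    unfolding direct_sum_def
  proof (intro conjI allI impI)
    show "\<forall>d\<in>UNIV. subspace (U \<inter> gr d)"
      using direct_sum_subspace[OF V(1)] by (auto intro!: subspace_inter simp: U)
    have "(l ^^ i) z \<in> (\<Union>d. U \<inter> gr d)" if "i < m" for i
      using hom[of i] that by (auto simp: U intro!: span_base)
    then have "U \<subseteq> span (\<Union>d. U \<inter> gr d)" 
      by (subst U) (auto intro!: span_mono)
    moreover have "span (\<Union>d. U \<inter> gr d) \<subseteq> U" by (rule span_minimal) (auto simp: U)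
    ultimately show "U = span (\<Union>d. U \<inter> gr d)" by blast
    fix J c assume "finite J \<and> J \<subseteq> UNIV \<and> (\<forall>i\<in>J. c i \<in> U \<inter> gr i) \<and> sum c J = 0"
    then show "\<forall>i\<in>J. c i = 0" using direct_sum_zeroD[OF V(1), of J c] by blast
  qed
  moreover have "\<exists>B. finite B \<and> U = span B" unfolding U by blast
  moreover have "linear_on scale U l" using V(2) UV by (auto simp: linear_on_def subset_iff)
  moreover have "\<forall>d. l ` (U \<inter> gr d) \<subseteq> U \<inter> gr (Suc d)" using lU V(6) by blast
  moreover have "\<exists>N. \<forall>x\<in>U. (l ^^ N) x = 0"
  proof -
    obtain N where "\<forall>x\<in>V. (l ^^ N) x = 0" using gn unfolding graded_nilpotent_def by metis
    then show ?thesis using UV by (intro exI[of _ N]) auto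
  qed
  ultimately have "graded_nilpotent scale U (\<lambda>d. U \<inter> gr d) l" by (simp add: graded_nilpotent_def)
  moreover have "z \<in> U" 
    unfolding U using m by (intro span_base image_eqI[of _ _ 0]) auto
  ultimately show ?thesis unfolding is_string_iff using z m ind U by blast
qed

text \<open>
  A string decomposition amounts to a homogeneous basis \<open>(l\<^sup>i (z j))\<close>, one block \<open>j\<close> for each string.
  The index set of that basis depends only on the lengths \<open>fst (ps ! j)\<close>; the initial degrees
  \<open>snd (ps ! j)\<close> enter through the grading.
\<close>
definition string_index :: "(nat \<times> nat) list \<Rightarrow> (nat \<times> nat) set" where
  "string_index ps = (SIGMA j:{..<length ps}. {..<fst (ps ! j)})"

definition string_vector :: "('b \<Rightarrow> 'b) \<Rightarrow> (nat \<Rightarrow> 'b) \<Rightarrow> nat \<times> nat \<Rightarrow> 'b" where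
  "string_vector l z = (\<lambda>(j, i). (l ^^ i) (z j))"

definition string_basis ::
    "'b set \<Rightarrow> (nat \<Rightarrow> 'b set) \<Rightarrow> ('b \<Rightarrow> 'b) \<Rightarrow> (nat \<times> nat) list \<Rightarrow> (nat \<Rightarrow> 'b) \<Rightarrow> bool" where
  "string_basis V gr l ps z \<longleftrightarrow>
     (\<forall>j<length ps. 1 \<le> fst (ps ! j) \<and> z j \<in> gr (snd (ps ! j)) \<and> (l ^^ fst (ps ! j)) (z j) = 0) \<and>
     indep_family (string_index ps) (string_vector l z) \<and>
     span (string_vector l z ` string_index ps) = V"

lemma finite_string_index [simp]: "finite (string_index ps)"
  by (simp add: string_index_def)

lemma string_basisD:
  assumes "string_basis V gr l ps z"
  shows "indep_family (string_index ps) (string_vector l z)"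
    and "span (string_vector l z ` string_index ps) = V"
    and "j < length ps \<Longrightarrow> 1 \<le> fst (ps ! j)"
    and "j < length ps \<Longrightarrow> z j \<in> gr (snd (ps ! j))"
    and "j < length ps \<Longrightarrow> (l ^^ fst (ps ! j)) (z j) = 0"
  using assms by (simp_all add: string_basis_def)

lemma string_decomposition_of_basis:
  assumes gn: "graded_nilpotent scale V gr l" and bas: "string_basis V gr l ps z"
  shows "string_decomposition scale V gr l (mset ps)"
proof -
  define U where "U j = span (string_vector l z ` {q \<in> string_index ps. fst q = j})" for j
  have ds: "direct_sum scale {..<length ps} U V"
    unfolding U_def string_basisD(2)[OF bas, symmetric]
    by (rule direct_sum_of_indep_family[OF finite_string_index string_basisD(1)[OF bas]])
      (auto simp: string_index_def)
  have str: "is_string scale (U j) (\<lambda>d. U j \<inter> gr d) l (fst (ps ! j)) (snd (ps ! j))"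
    if j: "j < length ps" for j
  proof (rule is_string_span_orbit[OF gn, of "z j"])
    have fibre: "{q \<in> string_index ps. fst q = j} = Pair j ` {..<fst (ps ! j)}"
      using j by (auto simp: string_index_def)
    have "indep_family (Pair j ` {..<fst (ps ! j)}) (string_vector l z)"
      by (rule indep_family_mono[OF string_basisD(1)[OF bas]]) (simp_all flip: fibre)
    from indep_family_reindex[OF this, of "Pair j" "{..<fst (ps ! j)}"]
    show "indep_family {..<fst (ps ! j)} (\<lambda>i. (l ^^ i) (z j))"
      by (simp add: string_vector_def inj_on_def)
    show "U j = span ((\<lambda>i. (l ^^ i) (z j)) ` {..<fst (ps ! j)})"
      by (simp add: U_def fibre image_image string_vector_def)
  qed (use string_basisD(3-5)[OF bas j] in simp_all)
  show ?thesis unfolding string_decomposition_def using gn ds str by blast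
qed

lemma string_decomposition_basisE:
  assumes "string_decomposition scale V gr l M"
  obtains ps z where "mset ps = M" "string_basis V gr l ps z"
proof -
  from assms obtain ps U where ps: "mset ps = M" and ds: "direct_sum scale {..<length ps} U V"
    and str: "\<And>j. j < length ps \<Longrightarrow>
      is_string scale (U j) (\<lambda>d. U j \<inter> gr d) l (fst (ps ! j)) (snd (ps ! j))"
    unfolding string_decomposition_def by blast
  have "\<forall>j. \<exists>z. j < length ps \<longrightarrow> 1 \<le> fst (ps ! j) \<and> z \<in> gr (snd (ps ! j)) \<and>
      (l ^^ fst (ps ! j)) z = 0 \<and> indep_family {..<fst (ps ! j)} (\<lambda>i. (l ^^ i) z) \<and>
      span ((\<lambda>i. (l ^^ i) z) ` {..<fst (ps ! j)}) = U j"
    using str unfolding is_string_iff by blast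
  then obtain z where z: "\<And>j. j < length ps \<Longrightarrow> 1 \<le> fst (ps ! j) \<and> z j \<in> gr (snd (ps ! j)) \<and>
      (l ^^ fst (ps ! j)) (z j) = 0 \<and> indep_family {..<fst (ps ! j)} (\<lambda>i. (l ^^ i) (z j)) \<and>
      span ((\<lambda>i. (l ^^ i) (z j)) ` {..<fst (ps ! j)}) = U j"
    by metis
  have "string_basis V gr l ps z"
    unfolding string_basis_def string_index_def string_vector_def
    using z indep_family_Sigma[OF ds, of "\<lambda>j. {..<fst (ps ! j)}" "\<lambda>j i. (l ^^ i) (z j)"]
    by auto
  with ps that show ?thesis by blast
qed

section \<open>Uniqueness of the Jordan degree type\<close>

text \<open>
  \<open>gr d\<close> is spanned by the basis vectors of degree \<open>d\<close>, at most one from each string.  The power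
  \<open>l\<^sup>i\<close> moves such a vector along its string to degree \<open>d + i\<close>, or to zero when the string has
  ended; the surviving images are distinct basis vectors.
\<close>
lemma dim_image_graded_piece:
  assumes gn: "graded_nilpotent scale V gr l" and bas: "string_basis V gr l ps z"
  shows "dim ((l ^^ i) ` gr d) = size {#(p, \<nu>) \<in># mset ps. \<nu> \<le> d \<and> d + i < \<nu> + p#}"
proof -
  note V = graded_nilpotentD[OF gn]
  let ?I = "string_index ps" and ?b = "string_vector l z"
  define g where "g = (\<lambda>(j, k). snd (ps ! j) + k)"
  have zj: "1 \<le> fst (ps ! j)" "z j \<in> gr (snd (ps ! j))" "(l ^^ fst (ps ! j)) (z j) = 0" if "j < length ps" for j
    using string_basisD(3-5)[OF bas that] .
  have hom: "?b q \<in> gr (g q)" if "q \<in> ?I" for q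
    using that orbit_homogeneous[OF gn zj(2)] by (auto simp: string_index_def string_vector_def g_def)
  have homV: "?b q \<in> V" if "q \<in> ?I" for q
    using V(7)[of "g q"] hom[OF that] by (rule subsetD)
  have grd: "gr d = span (?b ` {q\<in>?I. g q = d})"
    using graded_piece_eq_span[OF V(1), of ?I ?b g d] hom string_basisD(2)[OF bas] by simp
  \<comment> \<open>The strings that occupy both degrees, and for each of them the basis vector in degree \<open>d + i\<close>.\<close>
  define K where "K = {j. j < length ps \<and> snd (ps ! j) \<le> d \<and> d + i < snd (ps ! j) + fst (ps ! j)}"
  define h where "h j = (j, d - snd (ps ! j) + i)" for j
  have b_shift: "(l ^^ i) (?b (j, k)) = ?b (j, k + i)" for j k
    by (simp add: string_vector_def funpow_add add.commute[of k])
  have "(l ^^ i) ` gr d = span ((\<lambda>q. (l ^^ i) (?b q)) ` {q\<in>?I. g q = d})"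
    unfolding grd
  proof (rule linear_on_image_span)
    show "linear_on scale V (l ^^ i)" using linear_on_funpow[OF V(2,4)] by blast
    show "?b ` {q \<in> ?I. g q = d} \<subseteq> V" using homV by auto
  qed (use V(3) in auto)
  also have "\<dots> = span ((\<lambda>j. ?b (h j)) ` K)"
  proof (rule subset_antisym; rule span_minimal[OF _ subspace_span]; rule image_subsetI)
    fix q assume q: "q \<in> {q\<in>?I. g q = d}"
    then obtain j k where jk: "q = (j, k)" by (cases q)
    then have j: "j < length ps" and k: "k < fst (ps ! j)" and d: "d = snd (ps ! j) + k"
      using q by (auto simp: string_index_def g_def)
    show "(l ^^ i) (?b q) \<in> span ((\<lambda>j. ?b (h j)) ` K)"
    proof (cases "k + i < fst (ps ! j)")
      case True
      then show ?thesis unfolding jk b_shift using j d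
        by (intro span_base image_eqI[of _ _ j]) (auto simp: h_def K_def)
    next
      case False
      then have "?b (j, k + i) = 0"
        using orbit_vanishes[OF V(5) zj(3)[OF j]] by (simp add: string_vector_def)
      then show ?thesis unfolding jk b_shift by (simp add: span_zero)
    qed
  next
    fix j assume j: "j \<in> K"
    then show "?b (h j) \<in> span ((\<lambda>q. (l ^^ i) (?b q)) ` {q\<in>?I. g q = d})"
      by (intro span_base image_eqI[of _ _ "(j, d - snd (ps ! j))"])
        (auto simp: h_def b_shift K_def g_def string_index_def)
  qed
  also have "dim \<dots> = card K"
  proof (rule dim_span_family)
    show "finite K" by (simp add: K_def)
    have "indep_family (h ` K) ?b"
      by (rule indep_family_mono[OF string_basisD(1)[OF bas]])
        (auto simp: string_index_def K_def h_def)
    then show "indep_family K (\<lambda>j. ?b (h j))"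
      by (rule indep_family_reindex) (auto simp: h_def inj_on_def)
  qed
  also have "K = {j. j < length ps \<and> (case ps ! j of (p, \<nu>) \<Rightarrow> \<nu> \<le> d \<and> d + i < \<nu> + p)}"
    by (simp add: K_def case_prod_unfold)
  also have "card \<dots> = size {#(p, \<nu>) \<in># mset ps. \<nu> \<le> d \<and> d + i < \<nu> + p#}"
    by (simp add: length_filter_conv_card flip: mset_filter)
  finally show ?thesis .
qed

end

text \<open>
  Two differences recover the multiplicities.  A string occupying degrees \<open>d + 1\<close> and \<open>d + 1 + i\<close>
  either begins in degree \<open>d + 1\<close> or already occupies degree \<open>d\<close>; and a string of length more
  than \<open>i\<close> either has length exactly \<open>i + 1\<close> or length more than \<open>i + 1\<close>.
\<close>
lemma string_multiset_eqI:
  fixes M M' :: "(nat \<times> nat) multiset"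
  assumes eq: "\<And>d i. size {#(p, \<nu>) \<in># M. \<nu> \<le> d \<and> d + i < \<nu> + p#} =
      size {#(p, \<nu>) \<in># M'. \<nu> \<le> d \<and> d + i < \<nu> + p#}"
    and pos: "\<And>\<nu>. (0, \<nu>) \<notin># M" "\<And>\<nu>. (0, \<nu>) \<notin># M'"
  shows "M = M'"
proof -
  \<comment> \<open>\<open>A\<close> counts strings that occupy degrees \<open>d\<close> and \<open>d + i\<close>; \<open>S\<close> counts those of length more than \<open>i\<close> that begin in degree \<open>d\<close>.\<close>
  define A where "A M d i = size {#(p, \<nu>) \<in># M. \<nu> \<le> d \<and> d + i < \<nu> + p#}"
    for M :: "(nat \<times> nat) multiset" and d i
  define S where "S M d i = size {#(p, \<nu>) \<in># M. \<nu> = d \<and> i < p#}"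
    for M :: "(nat \<times> nat) multiset" and d i
  have A0: "S M 0 i = A M 0 i" for M i
    unfolding A_def S_def by (induction M) auto
  have A_Suc: "A M (Suc d) i = S M (Suc d) i + A M d (Suc i)" for M d i
    unfolding A_def S_def by (induction M) auto
  have S_Suc: "S M d i = count M (Suc i, d) + S M d (Suc i)" for M d i
    unfolding S_def by (induction M) auto
  have A: "A M d i = A M' d i" for d i using eq by (simp add: A_def)
  have S: "S M d i = S M' d i" for d i
    using A0[of M i] A0[of M' i] A_Suc[of M "d - 1" i] A_Suc[of M' "d - 1" i] A
    by (cases d) auto
  show ?thesis
  proof (rule multiset_eqI, clarify)
    fix p \<nu>
    show "count M (p, \<nu>) = count M' (p, \<nu>)"
    proof (cases p)
      case 0
      then show ?thesis using pos by (simp add: count_eq_zero_iff[THEN iffD2])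
    next
      case (Suc i)
      then show ?thesis using S_Suc[of M \<nu> i] S_Suc[of M' \<nu> i] S by simp
    qed
  qed
qed

context families
begin

lemma string_decomposition_unique:
  assumes "string_decomposition scale V gr l M" "string_decomposition scale V gr l M'"
  shows "M = M'"
proof -
  have gn: "graded_nilpotent scale V gr l" using assms(1) by (simp add: string_decomposition_def)
  have *: "size {#(p, \<nu>) \<in># N. \<nu> \<le> d \<and> d + i < \<nu> + p#} = dim ((l ^^ i) ` gr d) \<and> (0, \<nu>) \<notin># N"
    if N: "string_decomposition scale V gr l N" for N d i \<nu>
  proof -
    obtain ps z where ps: "mset ps = N" "string_basis V gr l ps z"
      using N by (rule string_decomposition_basisE)
    have "(0, \<nu>) \<notin> set ps"
      using string_basisD(3)[OF ps(2)] by (metis fst_conv in_set_conv_nth not_one_le_zero)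
    then show ?thesis using dim_image_graded_piece[OF gn ps(2)] ps(1) by auto
  qed
  show ?thesis by (rule string_multiset_eqI) (use *[OF assms(1)] *[OF assms(2)] in auto)
qed

lemma jordan_degree_type_eqI:
  "string_decomposition scale V gr l M \<Longrightarrow> jordan_degree_type scale V gr l = M"
  unfolding jordan_degree_type_def by (blast intro: the_equality string_decomposition_unique)

end

section \<open>Lowering operators\<close>

context families
begin

lemma linear_on_add:
  "linear_on scale V l \<Longrightarrow> x \<in> V \<Longrightarrow> y \<in> V \<Longrightarrow> l (x + y) = l x + l y"
  by (simp add: linear_on_def)

lemma linear_on_scale:
  "linear_on scale V l \<Longrightarrow> x \<in> V \<Longrightarrow> l (scale a x) = scale a (l x)"
  by (simp add: linear_on_def)

lemma linear_extension:
  assumes "finite I" "indep_family I b"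
  obtains F where "linear_on scale UNIV F" "\<And>i. i \<in> I \<Longrightarrow> F (b i) = f i"
proof -
  interpret vector_space_pair scale scale ..
  have ind: "independent (b ` I)" and inj: "inj_on b I"
    using assms by (simp_all add: indep_family_iff)
  let ?F = "construct (b ` I) (\<lambda>v. f (the_inv_into I b v))"
  interpret F: Vector_Spaces.linear scale scale ?F using ind by (rule linear_construct)
  have "linear_on scale UNIV ?F" unfolding linear_on_def by (simp add: F.add F.scale)
  moreover have "?F (b i) = f i" if "i \<in> I" for i
    using that inj by (subst construct_basis[OF ind]) (auto simp: the_inv_into_f_f)
  ultimately show ?thesis using that by blast
qed

text \<open>
  \<open>F\<close> moves down a ladder one rung at a time, so \<open>F\<^sup>r\<close> takes the \<open>r\<close>-th rung to a multiple of the
  bottom and kills every lower rung.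
\<close>
lemma lowering_ladder:
  assumes F: "linear_on scale UNIV F" and prim: "F (x 0) = 0"
    and step: "\<And>r. F (x (Suc r)) = scale (k r) (x r)"
  shows "(F ^^ r) (x r) = scale (\<Prod>i<r. k i) (x 0)"
    and "r' < r \<Longrightarrow> (F ^^ r) (x r') = 0"
proof -
  have F0: "F 0 = 0" using linear_on_zero[OF F] by simp
  have Fr: "linear_on scale UNIV (F ^^ r)" for r using linear_on_funpow[OF F] by simp
  show "(F ^^ r) (x r) = scale (\<Prod>i<r. k i) (x 0)"
    by (induction r)
      (simp_all add: funpow_Suc_right step linear_on_scale[OF Fr] mult.commute del: funpow.simps(2))
  have "(F ^^ Suc r) (x r) = 0" for r
  proof (induction r)
    case 0
    show ?case using prim by simp
  next
    case (Suc r)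
    have "(F ^^ Suc (Suc r)) (x (Suc r)) = scale (k r) ((F ^^ Suc r) (x r))"
      by (simp only: funpow_Suc_right[of "Suc r"] comp_apply step linear_on_scale[OF Fr UNIV_I])
    then show ?case using Suc by simp
  qed
  then show "r' < r \<Longrightarrow> (F ^^ r) (x r') = 0"
    using orbit_vanishes[where l = F, OF F0, of "Suc r'" "x r'" r] by simp
qed

text \<open>
  In a relation between ladders let \<open>R\<close> be the highest rung that occurs.  Applying \<open>F\<^sup>R\<close> kills the
  lower rungs and leaves a relation between the bottom vectors, whose coefficients must vanish.
\<close>
lemma indep_ladders:
  assumes F: "linear_on scale UNIV F" and A: "finite A"
    and prim: "\<And>a. a \<in> A \<Longrightarrow> F (x a 0) = 0"
    and step: "\<And>a r. a \<in> A \<Longrightarrow> F (x a (Suc r)) = scale (k a r) (x a r)"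
    and nz: "\<And>a r. a \<in> A \<Longrightarrow> Suc r < len a \<Longrightarrow> k a r \<noteq> 0"
    and ind: "indep_family A (\<lambda>a. x a 0)"
  shows "indep_family (SIGMA a:A. {..<len a}) (\<lambda>(a, r). x a r)"
  unfolding indep_family_def
proof (rule allI, rule impI, rule ccontr)
  fix c
  let ?I = "SIGMA a:A. {..<len a}"
  assume 0: "(\<Sum>q\<in>?I. scale (c q) (case q of (a, r) \<Rightarrow> x a r)) = 0" and nonzero: "\<not> (\<forall>q\<in>?I. c q = 0)"
  have finI: "finite ?I" using A by simp
  define Z where "Z = {q \<in> ?I. c q \<noteq> 0}"
  have Z: "finite Z" "Z \<noteq> {}" using finI nonzero by (auto simp: Z_def)
  define R where "R = Max (snd ` Z)"
  have "R \<in> snd ` Z" unfolding R_def using Z by (intro Max_in) auto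
  then obtain a0 where a0: "a0 \<in> A" "R < len a0" "c (a0, R) \<noteq> 0" by (auto simp: Z_def)
  have top: "r \<le> R" if "a \<in> A" "r < len a" "c (a, r) \<noteq> 0" for a r
    unfolding R_def using Z(1) that by (intro Max_ge) (force simp: Z_def)+
  have FR: "linear_on scale UNIV (F ^^ R)" using linear_on_funpow[OF F] by simp
  have inner: "(\<Sum>r<len a. scale (c (a, r)) ((F ^^ R) (x a r))) =
      scale (if R < len a then c (a, R) * (\<Prod>i<R. k a i) else 0) (x a 0)" if a: "a \<in> A" for a
  proof -
    have "scale (c (a, r)) ((F ^^ R) (x a r)) =
        (if r = R then scale (c (a, R) * (\<Prod>i<R. k a i)) (x a 0) else 0)" if "r < len a" for r
      using lowering_ladder[OF F prim[OF a] step[OF a]]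
        top[OF a that] by (cases r R rule: linorder_cases) auto
    then have "(\<Sum>r<len a. scale (c (a, r)) ((F ^^ R) (x a r))) =
        (\<Sum>r<len a. if r = R then scale (c (a, R) * (\<Prod>i<R. k a i)) (x a 0) else 0)"
      by (intro sum.cong) auto
    then show ?thesis by simp
  qed
  have "0 = (F ^^ R) (\<Sum>q\<in>?I. scale (c q) (case q of (a, r) \<Rightarrow> x a r))"
    using 0 linear_on_zero[OF FR] by simp
  also have "\<dots> = (\<Sum>q\<in>?I. scale (c q) ((F ^^ R) (case q of (a, r) \<Rightarrow> x a r)))"
    by (intro linear_on_sum[OF FR]) auto
  also have "\<dots> = (\<Sum>a\<in>A. \<Sum>r<len a. scale (c (a, r)) ((F ^^ R) (x a r)))"
    using A by (subst sum.Sigma) (auto simp: case_prod_unfold)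
  also have "\<dots> = (\<Sum>a\<in>A. scale (if R < len a then c (a, R) * (\<Prod>i<R. k a i) else 0) (x a 0))"
    by (intro sum.cong inner refl)
  finally have "(if R < len a0 then c (a0, R) * (\<Prod>i<R. k a0 i) else 0) = 0"
    by (intro indep_familyD[OF ind _ a0(1),
          of "\<lambda>a. if R < len a then c (a, R) * (\<Prod>i<R. k a i) else 0"]) (rule sym)
  moreover have "(\<Prod>i<R. k a0 i) \<noteq> 0" using nz[OF a0(1)] a0(2) by auto
  ultimately show False using a0 by simp
qed

end

section \<open>The grid of a tensor product of two strings\<close>

text \<open>
  \<open>e i j\<close> stands for \<open>l1\<^sup>i x \<otimes> l2\<^sup>j y\<close> for all \<open>i\<close> and \<open>j\<close>, hence is zero outside the rectangle; this
  makes the formulas for \<open>L\<close> and \<open>F\<close> free of boundary cases.  In the formula for \<open>F\<close> the truncated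
  subtractions \<open>i - 1\<close>, \<open>m - i\<close>, \<open>j - 1\<close>, \<open>n - j\<close> are harmless, because the coefficient is zero
  whenever \<open>i = 0\<close> or \<open>i \<ge> m\<close>, and likewise for \<open>j\<close>.
\<close>
locale string_grid = families +
  fixes m n :: nat and e :: "nat \<Rightarrow> nat \<Rightarrow> 'b" and L F :: "'b \<Rightarrow> 'b"
  assumes m_le_n: "m \<le> n"
    and char: "CHAR('a) = 0 \<or> CHAR('a) > (m - 1) + (n - 1)"
    and indep_e: "indep_family ({..<m} \<times> {..<n}) (\<lambda>(i, j). e i j)"
    and e_outside: "m \<le> i \<or> n \<le> j \<Longrightarrow> e i j = 0"
    and L_linear: "linear_on scale (span ((\<lambda>(i, j). e i j) ` ({..<m} \<times> {..<n}))) L"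
    and L_e: "L (e i j) = e (Suc i) j + e i (Suc j)"
    and F_linear: "linear_on scale UNIV F"
    and F_e: "F (e i j) = scale (of_nat (i * (m - i))) (e (i - 1) j) +
      scale (of_nat (j * (n - j))) (e i (j - 1))"
begin

definition top_degree :: nat where
  "top_degree = (m - 1) + (n - 1)"

definition grid :: "(nat \<times> nat) set" where
  "grid = {..<m} \<times> {..<n}"

definition whole :: "'b set" where
  "whole = span ((\<lambda>(i, j). e i j) ` grid)"

definition piece :: "nat \<Rightarrow> 'b set" where
  "piece d = span ((\<lambda>(i, j). e i j) ` {q \<in> grid. fst q + snd q = d})"

lemma finite_grid [simp]: "finite grid"
  by (simp add: grid_def)

lemma subspace_piece: "subspace (piece d)"
  by (simp add: piece_def)

lemma subspace_whole: "subspace whole"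
  by (simp add: whole_def)

lemma direct_sum_piece: "direct_sum scale UNIV piece whole"
  unfolding piece_def[abs_def] whole_def
  by (rule direct_sum_of_indep_family[OF finite_grid indep_e[folded grid_def]]) simp

lemma piece_subset: "piece d \<subseteq> whole"
  using direct_sum_subset[OF direct_sum_piece] by simp

lemma e_in_piece: "e i j \<in> piece (i + j)"
proof (cases "i < m \<and> j < n")
  case True
  then show ?thesis unfolding piece_def
    by (intro span_base image_eqI[of _ _ "(i, j)"]) (auto simp: grid_def)
next
  case False
  then have "e i j = 0" by (intro e_outside) auto
  then show ?thesis using subspace_0[OF subspace_piece] by simp
qed

lemma e_in_whole: "e i j \<in> whole"
  using piece_subset e_in_piece by (rule subsetD)

lemma piece_above_top: "top_degree < d \<Longrightarrow> piece d = {0}"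
proof -
  assume "top_degree < d"
  then have "{q \<in> grid. fst q + snd q = d} = {}" by (auto simp: top_degree_def grid_def)
  then show ?thesis unfolding piece_def by (simp only: image_empty span_empty)
qed

lemmas L_lin = L_linear[folded grid_def, folded whole_def]

lemma pieceE:
  assumes "x \<in> piece d"
  obtains c where "x = (\<Sum>q\<in>{q\<in>grid. fst q + snd q = d}. scale (c q) (case q of (i, j) \<Rightarrow> e i j))"
proof (rule span_familyE)
  show "x \<in> span ((\<lambda>(i, j). e i j) ` {q\<in>grid. fst q + snd q = d})"
    using assms by (simp add: piece_def)
qed (use that in simp_all)

lemma L_sum:
  assumes "\<And>i. i \<in> I \<Longrightarrow> b i \<in> whole"
  shows "L (\<Sum>i\<in>I. scale (c i) (b i)) = (\<Sum>i\<in>I. scale (c i) (L (b i)))"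
  using L_lin subspace_whole assms by (rule linear_on_sum)

lemma F_sum: "F (\<Sum>i\<in>I. scale (c i) (b i)) = (\<Sum>i\<in>I. scale (c i) (F (b i)))"
  by (rule linear_on_sum[OF F_linear]) auto

lemma F_zero: "F 0 = 0"
  using linear_on_zero[OF F_linear] by simp

lemma L_piece:
  assumes "x \<in> piece d"
  shows "L x \<in> piece (Suc d)"
proof -
  from assms obtain c where x:
    "x = (\<Sum>q\<in>{q\<in>grid. fst q + snd q = d}. scale (c q) (case q of (i, j) \<Rightarrow> e i j))"
    by (rule pieceE)
  have "L x = (\<Sum>q\<in>{q\<in>grid. fst q + snd q = d}. scale (c q) (L (case q of (i, j) \<Rightarrow> e i j)))"
    unfolding x by (rule L_sum) (auto simp: e_in_whole)
  also have "\<dots> \<in> piece (Suc d)"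
  proof (intro subspace_sum subspace_scale subspace_piece)
    fix q assume "q \<in> {q\<in>grid. fst q + snd q = d}"
    then show "L (case q of (i, j) \<Rightarrow> e i j) \<in> piece (Suc d)"
      using e_in_piece[of "Suc (fst q)" "snd q"] e_in_piece[of "fst q" "Suc (snd q)"]
      by (auto simp: L_e case_prod_unfold intro: subspace_add[OF subspace_piece])
  qed
  finally show ?thesis .
qed

lemma orbit_in_piece: "x \<in> piece d \<Longrightarrow> (L ^^ r) x \<in> piece (d + r)"
  by (induction r) (auto intro: L_piece)

lemma L_whole: "L ` whole \<subseteq> whole"
proof -
  have "L ` whole = span ((\<lambda>q. L (case q of (i, j) \<Rightarrow> e i j)) ` grid)"
    unfolding whole_def
    by (rule linear_on_image_span[OF L_lin subspace_whole finite_grid, folded whole_def])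
      (auto simp: e_in_whole)
  also have "\<dots> \<subseteq> whole"
    by (rule span_minimal) (auto simp: L_e e_in_whole subspace_add[OF subspace_whole] subspace_whole)
  finally show ?thesis .
qed

text \<open>
  The form in which the hypothesis on the characteristic is applied.
\<close>
lemma of_nat_nonzero: "0 < k \<Longrightarrow> k \<le> top_degree \<Longrightarrow> (of_nat k :: 'a) \<noteq> 0"
  using char unfolding top_degree_def of_nat_eq_0_iff_char_dvd by (auto dest: dvd_imp_le)

text \<open>
  The off-diagonal terms of \<open>FL\<close> and \<open>LF\<close> agree.  On the diagonal, \<open>(i+1)(m-1-i) - i(m-i) = m-1-2i\<close>
  and the same for \<open>j\<close> and \<open>n\<close>, which add up to \<open>(m-1) + (n-1) - 2(i+j)\<close>.
\<close>
lemma commutator_e: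
  assumes "i < m" "j < n"
  shows "F (L (e i j)) = L (F (e i j)) + scale (of_nat top_degree - 2 * of_nat (i + j)) (e i j)"
proof -
  let ?a = "of_nat (i * (m - i)) :: 'a" and ?b = "of_nat (j * (n - j)) :: 'a"
  have up: "scale ?a (e (Suc (i - 1)) j) = scale ?a (e i j)"
      "scale ?b (e i (Suc (j - 1))) = scale ?b (e i j)"
    by (cases i; simp) (cases j; simp)
  have LF: "L (F (e i j)) = scale (?a + ?b) (e i j) + scale ?a (e (i - 1) (Suc j)) + scale ?b (e (Suc i) (j - 1))"
    unfolding F_e linear_on_add[OF L_lin subspace_scale[OF subspace_whole e_in_whole] subspace_scale[OF subspace_whole e_in_whole]]
      linear_on_scale[OF L_lin e_in_whole] L_e scale_right_distrib up
    by (simp add: scale_left_distrib algebra_simps)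
  have "of_nat (Suc i * (m - Suc i)) + of_nat (Suc j * (n - Suc j)) =
      ?a + ?b + (of_nat top_degree - 2 * of_nat (i + j))"
  proof -
    obtain u v where mn: "m = Suc (i + u)" "n = Suc (j + v)"
      using assms less_imp_Suc_add by metis
    show ?thesis unfolding top_degree_def unfolding mn by (simp add: algebra_simps)
  qed
  then have diag: "scale (of_nat (Suc i * (m - Suc i))) (e i j) + scale (of_nat (Suc j * (n - Suc j))) (e i j) =
      scale (?a + ?b) (e i j) + scale (of_nat top_degree - 2 * of_nat (i + j)) (e i j)"
    by (simp flip: scale_left_distrib)
  have "F (L (e i j)) = (scale (of_nat (Suc i * (m - Suc i))) (e i j) + scale (of_nat (Suc j * (n - Suc j))) (e i j))
      + scale ?b (e (Suc i) (j - 1)) + scale ?a (e (i - 1) (Suc j))"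
    unfolding L_e linear_on_add[OF F_linear UNIV_I UNIV_I] F_e by (simp add: algebra_simps del: of_nat_mult of_nat_Suc)
  then show ?thesis unfolding diag LF by (simp add: algebra_simps del: of_nat_mult)
qed

lemma commutator:
  assumes "x \<in> piece d"
  shows "F (L x) = L (F x) + scale (of_nat top_degree - 2 * of_nat d) x"
proof -
  let ?I = "{q\<in>grid. fst q + snd q = d}" and ?e = "\<lambda>q. case q of (i, j) \<Rightarrow> e i j"
  from assms obtain c where x: "x = (\<Sum>q\<in>?I. scale (c q) (?e q))" by (rule pieceE)
  have whole: "?e q \<in> whole" "F (?e q) \<in> whole" for q
    by (auto simp: case_prod_unfold F_e e_in_whole intro!: subspace_add[OF subspace_whole] subspace_scale[OF subspace_whole])
  have "F (L x) = (\<Sum>q\<in>?I. scale (c q) (F (L (?e q))))"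
    unfolding x by (simp only: L_sum whole F_sum)
  also have "\<dots> = (\<Sum>q\<in>?I. scale (c q) (L (F (?e q)) + scale (of_nat top_degree - 2 * of_nat d) (?e q)))"
    by (rule sum.cong[OF refl]) (auto simp: grid_def commutator_e case_prod_unfold)
  also have "\<dots> = (\<Sum>q\<in>?I. scale (c q) (L (F (?e q)))) +
      scale (of_nat top_degree - 2 * of_nat d) x"
    unfolding x scale_sum_right sum.distrib[symmetric]
    by (simp add: scale_right_distrib mult.commute)
  also have "(\<Sum>q\<in>?I. scale (c q) (L (F (?e q)))) = L (F x)"
    unfolding x by (simp only: L_sum whole F_sum)
  finally show ?thesis .
qed

text \<open>
  The solution, normalised by \<open>prim_coeff a 0 = 1\<close>, of the two-term recurrence that expresses
  \<open>F (prim a) = 0\<close>.  The denominators are nonzero for \<open>i \<le> a < m\<close>.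
\<close>
definition prim_coeff :: "nat \<Rightarrow> nat \<Rightarrow> 'a" where
  "prim_coeff a i =
     (\<Prod>k<i. - of_nat ((a - k) * (n - (a - k))) / of_nat (Suc k * (m - Suc k)))"

definition prim :: "nat \<Rightarrow> 'b" where
  "prim a = (\<Sum>i\<le>a. scale (prim_coeff a i) (e i (a - i)))"

lemma prim_coeff_Suc:
  assumes "i < a" "a < m"
  shows "prim_coeff a (Suc i) * of_nat (Suc i * (m - Suc i)) =
    - (prim_coeff a i * of_nat ((a - i) * (n - (a - i))))"
proof -
  have "(of_nat (Suc i) :: 'a) \<noteq> 0" "(of_nat (m - Suc i) :: 'a) \<noteq> 0"
    using assms m_le_n by (intro of_nat_nonzero; simp add: top_degree_def)+
  then have "(of_nat (Suc i * (m - Suc i)) :: 'a) \<noteq> 0" unfolding of_nat_mult by (rule no_zero_divisors)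
  then show ?thesis by (simp add: prim_coeff_def del: of_nat_mult of_nat_Suc)
qed

lemma prim_in_piece: "prim a \<in> piece a"
  unfolding prim_def
proof (intro subspace_sum subspace_scale subspace_piece)
  fix i assume "i \<in> {..a}"
  then show "e i (a - i) \<in> piece a" using e_in_piece[of i "a - i"] by simp
qed

lemma prim_nonzero:
  assumes "a < m"
  shows "prim a \<noteq> 0"
proof
  assume 0: "prim a = 0"
  let ?f = "\<lambda>i. (i, a - i)"
  have "indep_family (?f ` {..a}) (\<lambda>(i, j). e i j)"
    using assms m_le_n by (intro indep_family_mono[OF indep_e]) auto
  then have "indep_family {..a} (\<lambda>i. case ?f i of (i, j) \<Rightarrow> e i j)"
    by (rule indep_family_reindex) (auto simp: inj_on_def)
  from indep_familyD[OF this, of "prim_coeff a" 0] 0 show False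
    by (simp add: prim_def prim_coeff_def)
qed

text \<open>
  The coefficient of \<open>e i (a-1-i)\<close> in \<open>F (prim a)\<close> has one contribution from \<open>e (i+1) (a-1-i)\<close> and
  one from \<open>e i (a-i)\<close>; they cancel by the recurrence.
\<close>
lemma F_prim:
  assumes "a < m"
  shows "F (prim a) = 0"
proof -
  \<comment> \<open>The contributions of the two summands of \<open>F\<close>; they are matched after shifting the first sum by one.\<close>
  define A where "A i = scale (prim_coeff a i * of_nat (i * (m - i))) (e (i - 1) (a - i))" for i
  define B where "B i = scale (prim_coeff a i * of_nat ((a - i) * (n - (a - i)))) (e i (a - i - 1))" for i
  have "F (prim a) = (\<Sum>i\<le>a. A i) + (\<Sum>i\<le>a. B i)"
    unfolding prim_def F_sum F_e A_def B_def sum.distrib[symmetric]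
    by (simp add: scale_right_distrib del: of_nat_mult)
  also have "(\<Sum>i\<le>a. A i) = (\<Sum>i<a. A (Suc i))"
    by (simp add: sum.atMost_shift A_def del: of_nat_mult of_nat_Suc mult_Suc)
  also have "(\<Sum>i\<le>a. B i) = (\<Sum>i<a. B i)"
    by (simp add: B_def flip: lessThan_Suc_atMost)
  also have "(\<Sum>i<a. A (Suc i)) + (\<Sum>i<a. B i) = 0"
    unfolding sum.distrib[symmetric]
  proof (rule sum.neutral, rule ballI)
    fix i assume "i \<in> {..<a}"
    then show "A (Suc i) + B i = 0"
      using prim_coeff_Suc[of i a] assms unfolding A_def B_def by simp
  qed
  finally show ?thesis .
qed

lemma indep_prim: "indep_family {..<m} prim"
  unfolding indep_family_def
proof (intro allI impI ballI)
  fix c a assume 0: "(\<Sum>a<m. scale (c a) (prim a)) = 0" and a: "a \<in> {..<m}"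
  have "scale (c a) (prim a) = 0"
    using subspace_scale[OF subspace_piece prim_in_piece]
    by (intro direct_sum_zeroD[OF direct_sum_piece _ _ _ 0 a]) auto
  then show "c a = 0" using prim_nonzero a by simp
qed

definition string_length :: "nat \<Rightarrow> nat" where
  "string_length a = m + n - 1 - 2 * a"

lemma orbit_prim_in_piece: "(L ^^ r) (prim a) \<in> piece (a + r)"
  by (rule orbit_in_piece[OF prim_in_piece])

definition ladder_coeff :: "nat \<Rightarrow> nat \<Rightarrow> 'a" where
  "ladder_coeff a r = of_nat (Suc r) * (of_nat top_degree - of_nat (2 * a + r))"

text \<open>
  Moving \<open>F\<close> past one more \<open>L\<close> adds \<open>N - 2(a+r)\<close>, with \<open>N\<close> the top degree, and these numbers sum to
  \<open>(r+1)(N-2a-r)\<close>.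
\<close>
lemma F_orbit_prim:
  assumes "a < m"
  shows "F ((L ^^ Suc r) (prim a)) = scale (ladder_coeff a r) ((L ^^ r) (prim a))"
proof (induction r)
  case 0
  show ?case
    using commutator[OF prim_in_piece] F_prim[OF assms] linear_on_zero[OF L_lin subspace_whole]
    by (simp add: ladder_coeff_def)
next
  case (Suc r)
  have "(L ^^ r) (prim a) \<in> whole" using piece_subset orbit_prim_in_piece by (rule subsetD)
  then have "F ((L ^^ Suc (Suc r)) (prim a)) =
      scale (ladder_coeff a r + (of_nat top_degree - 2 * of_nat (a + Suc r))) ((L ^^ Suc r) (prim a))"
    using commutator[OF orbit_prim_in_piece[of "Suc r" a]] Suc.IH
    by (simp add: linear_on_scale[OF L_lin] scale_left_distrib)
  also have "ladder_coeff a r + (of_nat top_degree - 2 * of_nat (a + Suc r)) = ladder_coeff a (Suc r)"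
    by (simp add: ladder_coeff_def algebra_simps)
  finally show ?case .
qed

lemma ladder_coeff_nonzero:
  assumes "a < m" "Suc r < string_length a"
  shows "ladder_coeff a r \<noteq> 0"
proof -
  have "ladder_coeff a r = of_nat (Suc r) * of_nat (top_degree - (2 * a + r))"
    using assms by (subst of_nat_diff) (auto simp: ladder_coeff_def string_length_def top_degree_def)
  then show ?thesis
    using assms of_nat_nonzero[of "Suc r"] of_nat_nonzero[of "top_degree - (2 * a + r)"]
    by (simp add: string_length_def top_degree_def del: of_nat_Suc)
qed

text \<open>
  Put \<open>q = string_length a\<close>.  In degree \<open>a + (q + a)\<close>, one above the top degree, the orbit is zero.
  If \<open>L\<^sup>r\<^sup>+\<^sup>1 (prim a) = 0\<close> with \<open>q \<le> r < q + a\<close>, then applying \<open>F\<close> gives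
  \<open>(r+1)(N-2a-r) L\<^sup>r (prim a) = 0\<close>, whose factor is now the negative of a product of two positive
  integers, both at most \<open>N\<close>; so the vanishing descends to \<open>r = q\<close>.
\<close>
lemma prim_string_ends:
  assumes "a < m"
  shows "(L ^^ string_length a) (prim a) = 0"
proof -
  \<comment> \<open>Downward induction, written as an upward one in the distance \<open>k\<close> from \<open>q + a\<close>.\<close>
  have "(L ^^ (string_length a + (a - k))) (prim a) = 0" if "k \<le> a" for k
    using that
  proof (induction k)
    case 0
    have "a + (string_length a + a) > top_degree"
      using assms m_le_n by (simp add: string_length_def top_degree_def)
    then show ?case using orbit_prim_in_piece[of "string_length a + a" a] by (simp add: piece_above_top)
  next
    case (Suc k)
    define r where "r = string_length a + (a - Suc k)"
    have r: "string_length a + (a - k) = Suc r" using Suc.prems by (simp add: r_def)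
    have "scale (ladder_coeff a r) ((L ^^ r) (prim a)) = 0"
      using F_orbit_prim[OF assms, of r] Suc.IH Suc.prems unfolding r by (simp add: F_zero)
    moreover have "ladder_coeff a r = - (of_nat (Suc r) * of_nat (a - k))"
    proof -
      have "2 * a + r = top_degree + (a - k)"
        using assms m_le_n Suc.prems by (simp add: r_def string_length_def top_degree_def)
      then show ?thesis unfolding ladder_coeff_def by (simp only: of_nat_add) simp
    qed
    moreover have "(of_nat (Suc r) :: 'a) \<noteq> 0" "(of_nat (a - k) :: 'a) \<noteq> 0"
      using assms m_le_n Suc.prems
      by (intro of_nat_nonzero; simp add: r_def string_length_def top_degree_def)+
    ultimately show ?case unfolding r_def[symmetric] by simp
  qed
  from this[of a] show ?thesis by simp
qed

lemma indep_prim_strings: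
  "indep_family (SIGMA a:{..<m}. {..<string_length a}) (\<lambda>(a, r). (L ^^ r) (prim a))"
  by (rule indep_ladders[OF F_linear, where k = ladder_coeff])
    (auto simp: F_prim F_orbit_prim ladder_coeff_nonzero indep_prim simp del: funpow.simps(2))

lemma sum_string_length: "(\<Sum>a<m. string_length a) = m * n"
proof -
  have "k \<le> m \<Longrightarrow> (\<Sum>a<k. string_length a) = k * (m + n - k)" for k
  proof (induction k)
    case (Suc k)
    have "(\<Sum>a<Suc k. string_length a) = k * (m + n - k) + string_length k" using Suc by simp
    also have "\<dots> = Suc k * (m + n - Suc k)"
    proof -
      obtain d d' where mn: "m = Suc k + d" "n = Suc k + d'"
        using Suc.prems m_le_n le_Suc_ex le_trans by metis
      show ?thesis unfolding string_length_def unfolding mn by (simp add: algebra_simps)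
    qed
    finally show ?case .
  qed simp
  from this[of m] show ?thesis by simp
qed

text \<open>
  By counting: the independent strings have \<open>m * n\<close> elements, as many as the basis \<open>e\<close>.
\<close>
lemma span_prim_strings:
  "span ((\<lambda>(a, r). (L ^^ r) (prim a)) ` (SIGMA a:{..<m}. {..<string_length a})) = whole"
  unfolding whole_def
proof (rule span_eq_of_card)
  let ?I = "SIGMA a:{..<m}. {..<string_length a}" and ?b = "\<lambda>(a, r). (L ^^ r) (prim a)"
  have b: "inj_on ?b ?I" "independent (?b ` ?I)"
    using indep_prim_strings by (simp_all add: indep_family_iff)
  have e: "inj_on (\<lambda>(i, j). e i j) grid"
    using indep_e by (simp add: indep_family_iff grid_def)
  show "independent (?b ` ?I)" by (rule b)
  show "?b ` ?I \<subseteq> span ((\<lambda>(i, j). e i j) ` grid)"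
    using subsetD[OF piece_subset orbit_prim_in_piece] by (auto simp: whole_def)
  show "card (?b ` ?I) = card ((\<lambda>(i, j). e i j) ` grid)"
    by (simp add: card_image[OF b(1)] card_image[OF e] sum_string_length)
      (simp add: grid_def)
qed simp

end

section \<open>Bases of tensor products\<close>

lemma free_eval_superset:
  assumes "vector_space sT" "finite K" "Poly_Mapping.keys f \<subseteq> K"
  shows "free_eval sT g f = (\<Sum>x\<in>K. sT (Poly_Mapping.lookup f x) (g x))"
proof -
  interpret vector_space sT by fact
  show ?thesis unfolding free_eval_def
    using assms(2,3) by (intro sum.mono_neutral_left) (auto simp: Poly_Mapping.in_keys_iff)
qed

lemma free_eval_linear:
  assumes "vector_space sT"
  shows "Vector_Spaces.linear free_scale sT (free_eval sT g)"
proof -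
  interpret T: vector_space sT by fact
  have "free_eval sT g (f + h) = free_eval sT g f + free_eval sT g h" for f h
  proof -
    let ?K = "Poly_Mapping.keys f \<union> Poly_Mapping.keys h"
    have "Poly_Mapping.keys (f + h) \<subseteq> ?K" by (rule Poly_Mapping.keys_add)
    then show ?thesis
      by (simp add: free_eval_superset[OF assms, of ?K] Poly_Mapping.lookup_add T.scale_left_distrib sum.distrib)
  qed
  moreover have "free_eval sT g (free_scale a f) = sT a (free_eval sT g f)" for a f
  proof -
    have "Poly_Mapping.keys (free_scale a f) \<subseteq> Poly_Mapping.keys f"
      by (auto simp: Poly_Mapping.in_keys_iff lookup_free_scale)
    then show ?thesis
      by (simp add: free_eval_superset[OF assms, of "Poly_Mapping.keys f"] lookup_free_scale T.scale_sum_right)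
  qed
  ultimately show ?thesis
    unfolding Vector_Spaces.linear_iff using assms free.vector_space_axioms by blast
qed

lemma free_eval_single:
  assumes "vector_space sT"
  shows "free_eval sT g (Poly_Mapping.single x 1) = g x"
proof -
  interpret vector_space sT by fact
  show ?thesis by (simp add: free_eval_def)
qed

text \<open>
  The definition of a tensor product as the quotient of a free space by the bilinearity relations
  yields what is needed below: \<open>\<tau>\<close> is bilinear, and products of bases are bases.
\<close>
locale tensor_product =
  sV: families sV + sW: families sW + sT: families sT
  for sV :: "'k::field \<Rightarrow> 'v::ab_group_add \<Rightarrow> 'v" and sW :: "'k \<Rightarrow> 'w::ab_group_add \<Rightarrow> 'w"
    and sT :: "'k \<Rightarrow> 'u::ab_group_add \<Rightarrow> 'u" +
  fixes V W T \<tau>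
  assumes subspace_V: "sV.subspace V" and subspace_W: "sW.subspace W"
    and is_tensor: "is_tensor_product sV V sW W sT T \<tau>"
begin

definition tensor_eval :: "(('v \<times> 'w) \<Rightarrow>\<^sub>0 'k) \<Rightarrow> 'u" where
  "tensor_eval = free_eval sT (\<lambda>(v, w). \<tau> v w)"

sublocale eval: Vector_Spaces.linear free_scale sT tensor_eval
  unfolding tensor_eval_def by (rule free_eval_linear) (rule sT.vector_space_axioms)

lemma tensor_eval_single [simp]: "tensor_eval (Poly_Mapping.single (v, w) 1) = \<tau> v w"
  unfolding tensor_eval_def using sT.vector_space_axioms by (simp add: free_eval_single)

lemma tensor_eval_image: "tensor_eval ` {f. Poly_Mapping.keys f \<subseteq> V \<times> W} = T"
  using is_tensor by (simp add: is_tensor_product_def Let_def tensor_eval_def)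

lemma tensor_eval_kernel:
  "{f. Poly_Mapping.keys f \<subseteq> V \<times> W \<and> tensor_eval f = 0} = free.span (tensor_relations sV V sW W)"
  using is_tensor by (simp add: is_tensor_product_def Let_def tensor_eval_def)

lemma tensor_eval_relation: "f \<in> tensor_relations sV V sW W \<Longrightarrow> tensor_eval f = 0"
  using tensor_eval_kernel free.span_base by blast

lemma tau_add_left:
  assumes "v \<in> V" "v' \<in> V" "w \<in> W" shows "\<tau> (v + v') w = \<tau> v w + \<tau> v' w"
proof -
  have "Poly_Mapping.single (v + v', w) 1 - Poly_Mapping.single (v, w) 1 - Poly_Mapping.single (v', w) 1
      \<in> tensor_relations sV V sW W"
    unfolding tensor_relations_def Let_def using assms by blast
  from tensor_eval_relation[OF this] show ?thesis by (simp add: eval.diff diff_eq_eq add.commute)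
qed

lemma tau_add_right:
  assumes "v \<in> V" "w \<in> W" "w' \<in> W" shows "\<tau> v (w + w') = \<tau> v w + \<tau> v w'"
proof -
  have "Poly_Mapping.single (v, w + w') 1 - Poly_Mapping.single (v, w) 1 - Poly_Mapping.single (v, w') 1
      \<in> tensor_relations sV V sW W"
    unfolding tensor_relations_def Let_def using assms by blast
  from tensor_eval_relation[OF this] show ?thesis by (simp add: eval.diff diff_eq_eq add.commute)
qed

lemma tau_scale_left:
  assumes "v \<in> V" "w \<in> W" shows "\<tau> (sV a v) w = sT a (\<tau> v w)"
proof -
  have "Poly_Mapping.single (sV a v, w) 1 - free_scale a (Poly_Mapping.single (v, w) 1)
      \<in> tensor_relations sV V sW W"
    unfolding tensor_relations_def Let_def using assms by blast
  from tensor_eval_relation[OF this] show ?thesis by (simp add: eval.diff eval.scale)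
qed

lemma tau_scale_right:
  assumes "v \<in> V" "w \<in> W" shows "\<tau> v (sW a w) = sT a (\<tau> v w)"
proof -
  have "Poly_Mapping.single (v, sW a w) 1 - free_scale a (Poly_Mapping.single (v, w) 1)
      \<in> tensor_relations sV V sW W"
    unfolding tensor_relations_def Let_def using assms by blast
  from tensor_eval_relation[OF this] show ?thesis by (simp add: eval.diff eval.scale)
qed

lemma tau_zero_left: "w \<in> W \<Longrightarrow> \<tau> 0 w = 0"
  using tau_scale_left[of 0 w 0] sV.subspace_0[OF subspace_V] by simp

lemma tau_zero_right: "v \<in> V \<Longrightarrow> \<tau> v 0 = 0"
  using tau_scale_right[of v 0 0] sW.subspace_0[OF subspace_W] by simp

lemma T_eq_span: "T = sT.span {\<tau> v w |v w. v \<in> V \<and> w \<in> W}"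
proof
  have "tensor_eval f \<in> sT.span {\<tau> v w |v w. v \<in> V \<and> w \<in> W}" if "Poly_Mapping.keys f \<subseteq> V \<times> W" for f
    unfolding tensor_eval_def free_eval_def using that
    by (intro sT.span_sum sT.span_scale sT.span_base) auto
  then show "T \<subseteq> sT.span {\<tau> v w |v w. v \<in> V \<and> w \<in> W}"
    unfolding tensor_eval_image[symmetric] by auto
  have "free.subspace {f. Poly_Mapping.keys f \<subseteq> V \<times> W}"
    unfolding free.subspace_def
    by (auto simp: lookup_free_scale Poly_Mapping.in_keys_iff dest!: subsetD[OF Poly_Mapping.keys_add])
  then have "sT.subspace T"
    unfolding tensor_eval_image[symmetric] by (rule eval.subspace_image)
  moreover have "\<tau> v w \<in> T" if "v \<in> V" "w \<in> W" for v w
    unfolding tensor_eval_image[symmetric] using that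
    by (intro image_eqI[of _ _ "Poly_Mapping.single (v, w) 1"]) auto
  ultimately show "sT.span {\<tau> v w |v w. v \<in> V \<and> w \<in> W} \<subseteq> T"
    by (intro sT.span_minimal) auto
qed

lemma tau_in_span:
  assumes "A \<subseteq> V" "B \<subseteq> W" "v \<in> sV.span A" "w \<in> sW.span B"
  shows "\<tau> v w \<in> sT.span {\<tau> a b |a b. a \<in> A \<and> b \<in> B}"
proof -
  let ?S = "sT.span {\<tau> a b |a b. a \<in> A \<and> b \<in> B}"
  have AV: "sV.span A \<subseteq> V" and BW: "sW.span B \<subseteq> W"
    using assms(1,2) subspace_V subspace_W by (simp_all add: sV.span_minimal sW.span_minimal)
  have fix_a: "\<tau> a w \<in> ?S \<and> w \<in> W" if "a \<in> A" for a
    using assms(4)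
  proof (induction rule: sW.span_induct_alt)
    case base
    then show ?case using that assms(1) subspace_W
      by (simp add: tau_zero_right sT.span_zero sW.subspace_0 subset_iff)
  next
    case (step c x y)
    have V: "a \<in> V" "x \<in> W" using that step(1) assms(1,2) by auto
    have "\<tau> a x \<in> ?S" using that step(1) by (intro sT.span_base) auto
    then show ?case using step(2) V subspace_W
      by (simp add: tau_add_right tau_scale_right sW.subspace_scale sW.subspace_add sT.span_add sT.span_scale)
  qed
  have w: "w \<in> W" using BW assms(4) by auto
  have "\<tau> v w \<in> ?S \<and> v \<in> V"
    using assms(3)
  proof (induction rule: sV.span_induct_alt)
    case base
    then show ?case using w subspace_V by (simp add: tau_zero_left sT.span_zero sV.subspace_0)
  next
    case (step c x y)
    have V: "x \<in> V" using step(1) assms(1) by auto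
    show ?case using step(2) V w subspace_V fix_a[OF step(1)]
      by (simp add: tau_add_left tau_scale_left sV.subspace_scale sV.subspace_add sT.span_add sT.span_scale)
  qed
  then show ?thesis ..
qed

text \<open>
  A weak form of the universal property, for the bilinear form \<open>\<alpha> v * \<beta> w\<close>: its linear extension to
  the free space vanishes on the bilinearity relations, hence on the kernel of the evaluation.
\<close>
lemma tensor_functional:
  assumes \<alpha>: "\<And>x y. x \<in> V \<Longrightarrow> y \<in> V \<Longrightarrow> \<alpha> (x + y) = \<alpha> x + \<alpha> y" "\<And>a x. x \<in> V \<Longrightarrow> \<alpha> (sV a x) = a * \<alpha> x"
    and \<beta>: "\<And>x y. x \<in> W \<Longrightarrow> y \<in> W \<Longrightarrow> \<beta> (x + y) = \<beta> x + \<beta> y" "\<And>a x. x \<in> W \<Longrightarrow> \<beta> (sW a x) = a * \<beta> x"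
    and I: "finite I" "\<And>i. i \<in> I \<Longrightarrow> v i \<in> V \<and> w i \<in> W" 
    and zero: "(\<Sum>i\<in>I. sT (c i) (\<tau> (v i) (w i))) = 0"
  shows "(\<Sum>i\<in>I. c i * (\<alpha> (v i) * \<beta> (w i))) = 0"
proof -
  have K: "vector_space ((*) :: 'k \<Rightarrow> 'k \<Rightarrow> 'k)" by unfold_locales (auto simp: algebra_simps)
  define \<phi> where "\<phi> = free_eval ((*) :: 'k \<Rightarrow> 'k \<Rightarrow> 'k) (\<lambda>(x, y). \<alpha> x * \<beta> y)"
  interpret \<phi>: Vector_Spaces.linear free_scale "(*)" \<phi> unfolding \<phi>_def by (rule free_eval_linear[OF K])
  have single: "\<phi> (Poly_Mapping.single (x, y) 1) = \<alpha> x * \<beta> y" for x y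
    unfolding \<phi>_def by (simp add: free_eval_single[OF K])
  have "tensor_relations sV V sW W \<subseteq> {f. \<phi> f = 0}"
    unfolding tensor_relations_def Let_def
    by (auto simp: \<phi>.diff \<phi>.scale single \<alpha> \<beta>) (simp_all add: algebra_simps)
  then have kernel: "free.span (tensor_relations sV V sW W) \<subseteq> {f. \<phi> f = 0}"
    by (rule free.span_minimal) (rule \<phi>.subspace_kernel)
  define f where "f = (\<Sum>i\<in>I. free_scale (c i) (Poly_Mapping.single (v i, w i) 1))"
  have "Poly_Mapping.lookup f p = 0" if "p \<notin> V \<times> W" for p
    using that I(2) unfolding f_def
    by (auto simp: Poly_Mapping.lookup_sum lookup_free_scale Poly_Mapping.lookup_single when_def intro!: sum.neutral)
  then have "Poly_Mapping.keys f \<subseteq> V \<times> W" by (meson Poly_Mapping.in_keys_iff subsetI)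
  moreover have "tensor_eval f = 0" using zero by (simp add: f_def eval.sum eval.scale)
  ultimately have "\<phi> f = 0" using kernel tensor_eval_kernel by blast
  then show ?thesis by (simp add: f_def \<phi>.sum \<phi>.scale single)
qed

text \<open>
  The coefficient \<open>c (i0, j0)\<close> is extracted by the product of the coordinate functional of \<open>V\<close> at
  \<open>x i0\<close> and that of \<open>W\<close> at \<open>y j0\<close>.
\<close>
lemma indep_family_tensor:
  assumes fin: "finite I" "finite J"
    and x: "sV.indep_family I x" "sV.span (x ` I) = V"
    and y: "sW.indep_family J y" "sW.span (y ` J) = W"
  shows "sT.indep_family (I \<times> J) (\<lambda>(i, j). \<tau> (x i) (y j))"
  unfolding sT.indep_family_def
proof (intro allI impI ballI)
  fix c q assume 0: "(\<Sum>q\<in>I \<times> J. sT (c q) (case q of (i, j) \<Rightarrow> \<tau> (x i) (y j))) = 0" and "q \<in> I \<times> J"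
  then obtain i0 j0 where q: "q = (i0, j0)" "i0 \<in> I" "j0 \<in> J" by auto
  have indx: "inj_on x I" "sV.independent (x ` I)" and indy: "inj_on y J" "sW.independent (y ` J)"
    using x(1) y(1) fin by (simp_all add: sV.indep_family_iff sW.indep_family_iff)
  define \<alpha> where "\<alpha> v = sV.representation (x ` I) v (x i0)" for v
  define \<beta> where "\<beta> w = sW.representation (y ` J) w (y j0)" for w
  have \<alpha>x: "\<alpha> (x i) = (if i = i0 then 1 else 0)" if "i \<in> I" for i
    using that q(2) indx by (auto simp: \<alpha>_def sV.representation_basis inj_on_eq_iff)
  have \<beta>y: "\<beta> (y j) = (if j = j0 then 1 else 0)" if "j \<in> J" for j
    using that q(3) indy by (auto simp: \<beta>_def sW.representation_basis inj_on_eq_iff)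
  have "(\<Sum>p\<in>I \<times> J. c p * (\<alpha> (x (fst p)) * \<beta> (y (snd p)))) = 0"
  proof (rule tensor_functional)
    show "x (fst p) \<in> V \<and> y (snd p) \<in> W" if "p \<in> I \<times> J" for p
      using that x(2) y(2) sV.span_base[of _ "x ` I"] sW.span_base[of _ "y ` J"] by auto
    show "(\<Sum>p\<in>I \<times> J. sT (c p) (\<tau> (x (fst p)) (y (snd p)))) = 0"
      using 0 by (simp add: case_prod_unfold)
  qed (use fin in \<open>simp_all add: \<alpha>_def \<beta>_def sV.representation_add[OF indx(2)] sW.representation_add[OF indy(2)]
      sV.representation_scale[OF indx(2)] sW.representation_scale[OF indy(2)] x(2) y(2)\<close>)
  also have "(\<Sum>p\<in>I \<times> J. c p * (\<alpha> (x (fst p)) * \<beta> (y (snd p)))) = (\<Sum>p\<in>I \<times> J. if p = q then c p else 0)"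
    by (rule sum.cong) (auto simp: \<alpha>x \<beta>y q split: if_splits)
  also have "\<dots> = c q" using fin q by simp
  finally show "c q = 0" .
qed

lemma span_tensor:
  assumes "sV.span (x ` I) = V" "sW.span (y ` J) = W"
  shows "sT.span ((\<lambda>(i, j). \<tau> (x i) (y j)) ` (I \<times> J)) = T"
proof -
  have eq: "{\<tau> a b |a b. a \<in> x ` I \<and> b \<in> y ` J} = (\<lambda>(i, j). \<tau> (x i) (y j)) ` (I \<times> J)" by auto
  have sub: "x ` I \<subseteq> V" "y ` J \<subseteq> W"
    using assms sV.span_superset sW.span_superset by blast+
  show ?thesis
    unfolding T_eq_span eq[symmetric]
  proof
    show "sT.span {\<tau> a b |a b. a \<in> x ` I \<and> b \<in> y ` J} \<subseteq> sT.span {\<tau> v w |v w. v \<in> V \<and> w \<in> W}"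
      using sub by (intro sT.span_mono) blast
    show "sT.span {\<tau> v w |v w. v \<in> V \<and> w \<in> W} \<subseteq> sT.span {\<tau> a b |a b. a \<in> x ` I \<and> b \<in> y ` J}"
      using tau_in_span[OF sub] assms by (intro sT.span_minimal) auto
  qed
qed

lemma tensor_grading_eq:
  assumes fin: "finite I" "finite J"
    and gr: "direct_sum sV UNIV grV V" "direct_sum sW UNIV grW W"
    and x: "sV.span (x ` I) = V" "\<And>i. i \<in> I \<Longrightarrow> x i \<in> grV (f i)"
    and y: "sW.span (y ` J) = W" "\<And>j. j \<in> J \<Longrightarrow> y j \<in> grW (g j)"
  shows "tensor_grading sT \<tau> grV grW d =
    sT.span ((\<lambda>(i, j). \<tau> (x i) (y j)) ` {(i, j) \<in> I \<times> J. f i + g j = d})"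
  unfolding tensor_grading_def
proof
  let ?R = "sT.span ((\<lambda>(i, j). \<tau> (x i) (y j)) ` {(i, j) \<in> I \<times> J. f i + g j = d})"
  have "x i \<in> V" if "i \<in> I" for i using that x(1) sV.span_base[of "x i" "x ` I"] by auto
  moreover have "y j \<in> W" if "j \<in> J" for j using that y(1) sW.span_base[of "y j" "y ` J"] by auto
  ultimately have sub: "x ` {i\<in>I. f i = a} \<subseteq> V" "y ` {j\<in>J. g j = b} \<subseteq> W" for a b by auto
  have "\<tau> v w \<in> ?R" if vw: "v \<in> grV a" "w \<in> grW b" "a + b = d" for v w a b
  proof -
    have "grV a = sV.span (x ` {i\<in>I. f i = a})"
      by (rule sV.graded_piece_eq_span[OF gr(1) fin(1) x(1)[symmetric]]) (use x(2) in auto)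
    moreover have "grW b = sW.span (y ` {j\<in>J. g j = b})"
      by (rule sW.graded_piece_eq_span[OF gr(2) fin(2) y(1)[symmetric]]) (use y(2) in auto)
    ultimately have "\<tau> v w \<in> sT.span {\<tau> a' b' |a' b'. a' \<in> x ` {i\<in>I. f i = a} \<and> b' \<in> y ` {j\<in>J. g j = b}}"
      using tau_in_span[OF sub] vw(1,2) by simp
    also have "\<dots> \<subseteq> ?R" using vw(3) by (intro sT.span_mono) auto
    finally show ?thesis .
  qed
  then show "sT.span {\<tau> v w |v w i j. v \<in> grV i \<and> w \<in> grW j \<and> i + j = d} \<subseteq> ?R"
    by (intro sT.span_minimal) auto
  show "?R \<subseteq> sT.span {\<tau> v w |v w i j. v \<in> grV i \<and> w \<in> grW j \<and> i + j = d}"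
    by (rule sT.span_mono) (use x(2) y(2) in fastforce)
qed

end

section \<open>The Clebsch-Gordan decomposition of a tensor product of strings\<close>

text \<open>
  The basis \<open>e i j\<close> of \<open>T\<close> and a lowering operator for it satisfy the assumptions of
  \<^locale>\<open>string_grid\<close>.  There degrees start at \<open>0\<close>, so they are shifted by \<open>s + t\<close>, the degree of
  \<open>e 0 0\<close>; the string with index \<open>a\<close> is the one with \<open>k = a + 1\<close>.
\<close>
theorem proposition3p10:
  fixes sV :: "'k::field \<Rightarrow> 'v::ab_group_add \<Rightarrow> 'v"
    and sW :: "'k \<Rightarrow> 'w::ab_group_add \<Rightarrow> 'w"
    and sT :: "'k \<Rightarrow> 'u::ab_group_add \<Rightarrow> 'u"
    and V :: "'v set" and W :: "'w set" and T :: "'u set"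
    and grV :: "nat \<Rightarrow> 'v set" and grW :: "nat \<Rightarrow> 'w set"
    and l1 :: "'v \<Rightarrow> 'v" and l2 :: "'w \<Rightarrow> 'w" and L :: "'u \<Rightarrow> 'u"
    and \<tau> :: "'v \<Rightarrow> 'w \<Rightarrow> 'u"
    and m n s t :: nat
  assumes "vector_space sV" and "vector_space sW" and "vector_space sT"
    and "1 \<le> m" and "m \<le> n"
    and "CHAR('k) = 0 \<or> CHAR('k) > (m - 1) + (n - 1)"
    and "is_string sV V grV l1 m s"
    and "is_string sW W grW l2 n t"
    and "is_tensor_product sV V sW W sT T \<tau>"
    and "is_tensor_operator sT V W T \<tau> l1 l2 L"
  shows "let gr = tensor_grading sT \<tau> grV grW;
             M = {# (n + m + 1 - 2 * k, s + t + k - 1). k \<in># mset_set {1..m} #}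
         in string_decomposition sT T gr L M \<and> jordan_degree_type sT T gr L = M"
proof -
  interpret sV: families sV by (rule families.intro) fact
  interpret sW: families sW by (rule families.intro) fact
  interpret sT: families sT by (rule families.intro) fact
  from \<open>is_string sV V grV l1 m s\<close> obtain x0 where gnV: "graded_nilpotent sV V grV l1"
    and x0: "x0 \<in> grV s" "sV.indep_family {..<m} (\<lambda>i. (l1 ^^ i) x0)"
      "sV.span ((\<lambda>i. (l1 ^^ i) x0) ` {..<m}) = V" "(l1 ^^ m) x0 = 0"
    unfolding sV.is_string_iff by blast
  from \<open>is_string sW W grW l2 n t\<close> obtain y0 where gnW: "graded_nilpotent sW W grW l2"
    and y0: "y0 \<in> grW t" "sW.indep_family {..<n} (\<lambda>j. (l2 ^^ j) y0)"
      "sW.span ((\<lambda>j. (l2 ^^ j) y0) ` {..<n}) = W" "(l2 ^^ n) y0 = 0"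
    unfolding sW.is_string_iff by blast
  note V = sV.graded_nilpotentD[OF gnV] and W = sW.graded_nilpotentD[OF gnW]
  interpret tensor_product sV sW sT V W T \<tau>
    by unfold_locales (rule V(3), rule W(3), fact)
  have xV: "(l1 ^^ i) x0 \<in> grV (s + i)" "(l1 ^^ i) x0 \<in> V" for i
    using sV.orbit_homogeneous[OF gnV x0(1)] subsetD[OF V(7)] by blast+
  have yW: "(l2 ^^ j) y0 \<in> grW (t + j)" "(l2 ^^ j) y0 \<in> W" for j
    using sW.orbit_homogeneous[OF gnW y0(1)] subsetD[OF W(7)] by blast+
  define e where "e i j = \<tau> ((l1 ^^ i) x0) ((l2 ^^ j) y0)" for i j
  let ?I = "{..<m} \<times> {..<n}" and ?e = "\<lambda>(i, j). e i j"
  have ind: "sT.indep_family ?I ?e"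
    unfolding e_def by (intro indep_family_tensor x0 y0) auto
  have spanT: "sT.span (?e ` ?I) = T"
    unfolding e_def by (intro span_tensor x0 y0)
  have e_outside: "e i j = 0" if "m \<le> i \<or> n \<le> j" for i j
    using that sV.orbit_vanishes[where l = l1, OF V(5) x0(4)] sW.orbit_vanishes[where l = l2, OF W(5) y0(4)]
      xV(2)[of i] yW(2)[of j] by (auto simp: e_def tau_zero_left tau_zero_right)
  have L: "linear_on sT T L" "L (e i j) = e (Suc i) j + e i (Suc j)" for i j
    using \<open>is_tensor_operator sT V W T \<tau> l1 l2 L\<close> xV(2)[of i] yW(2)[of j]
    by (auto simp: is_tensor_operator_def e_def)
  define f where "f = (\<lambda>(i, j). sT (of_nat (i * (m - i))) (e (i - 1) j) + sT (of_nat (j * (n - j))) (e i (j - 1)))"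
  have "finite ?I" by simp
  then obtain F where F: "linear_on sT UNIV F" and F_basis: "\<And>q. q \<in> ?I \<Longrightarrow> F (?e q) = f q"
    using ind sT.linear_extension by metis
  \<comment> \<open>For \<open>i \<ge> m\<close> or \<open>j \<ge> n\<close> each term on the right has a zero coefficient or a zero vector.\<close>
  have F_e: "F (e i j) = sT (of_nat (i * (m - i))) (e (i - 1) j) + sT (of_nat (j * (n - j))) (e i (j - 1))" for i j
  proof (cases "i < m \<and> j < n")
    case True
    then show ?thesis using F_basis[of "(i, j)"] by (simp add: f_def)
  next
    case False
    then show ?thesis using e_outside[of i j] e_outside[of i "j - 1"] e_outside[of "i - 1" j]
      sT.linear_on_zero[OF F] by auto
  qed
  interpret G: string_grid sT m n e L F
    using assms(5,6) ind e_outside L F F_e spanT by unfold_locales auto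
  have T: "G.whole = T" using spanT by (simp add: G.whole_def G.grid_def)
  define gr where "gr = tensor_grading sT \<tau> grV grW"
  have gr: "gr d = sT.span (?e ` {q \<in> ?I. s + t + (fst q + snd q) = d})" for d
  proof -
    have "gr d = sT.span ((\<lambda>(i, j). \<tau> ((l1 ^^ i) x0) ((l2 ^^ j) y0)) `
        {(i, j) \<in> ?I. (s + i) + (t + j) = d})"
      unfolding gr_def by (rule tensor_grading_eq) (use V(1) W(1) x0 y0 xV yW in auto)
    also have "{(i, j) \<in> ?I. (s + i) + (t + j) = d} = {q \<in> ?I. s + t + (fst q + snd q) = d}"
      by auto
    finally show ?thesis by (simp add: e_def)
  qed
  have gr_piece: "gr (s + t + d) = G.piece d" for d
    by (simp add: gr G.piece_def G.grid_def)
  \<comment> \<open>No \<open>d'\<close> satisfies \<open>d = s + t + d'\<close> here, so \<open>gr_piece\<close> says nothing about these degrees.\<close>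
  have gr_below: "gr d = {0}" if "d < s + t" for d
  proof -
    have "{q \<in> ?I. s + t + (fst q + snd q) = d} = {}" using that by auto
    then show ?thesis unfolding gr by (simp only: image_empty sT.span_empty)
  qed
  have gn: "graded_nilpotent sT T gr L"
    unfolding graded_nilpotent_def
  proof (intro conjI)
    show "\<exists>B. finite B \<and> T = sT.span B" using spanT by (intro exI[of _ "?e ` ?I"]) auto
    show "direct_sum sT UNIV gr T"
      unfolding spanT[symmetric] gr[abs_def]
      by (rule sT.direct_sum_of_indep_family[OF _ ind]) auto
    show "\<forall>d. L ` gr d \<subseteq> gr (Suc d)"
    proof
      fix d
      show "L ` gr d \<subseteq> gr (Suc d)"
      proof (cases "d < s + t")
        case True
        have "0 \<in> gr (Suc d)" by (simp add: gr sT.span_zero)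
        then show ?thesis using True sT.linear_on_zero[OF L(1)] G.subspace_whole T
          by (simp add: gr_below)
      next
        case False
        then obtain d' where "d = s + t + d'" by (metis le_Suc_ex not_less)
        then show ?thesis using G.L_piece gr_piece[of d'] gr_piece[of "Suc d'"] by auto
      qed
    qed
    show "\<exists>N. \<forall>x\<in>T. (L ^^ N) x = 0"
    proof (intro exI ballI)
      fix x assume "x \<in> T"
      let ?N = "Suc G.top_degree"
      have lin: "linear_on sT T (L ^^ ?N)"
        using sT.linear_on_funpow[OF L(1), of ?N] G.L_whole T by (simp del: funpow.simps)
      have vanish: "(L ^^ ?N) (?e q) = 0" for q
        using G.orbit_in_piece[OF G.e_in_piece[of "fst q" "snd q"], of ?N] G.piece_above_top[of "fst q + snd q + ?N"]
        by (simp add: case_prod_unfold del: funpow.simps)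
      obtain c where x: "x = (\<Sum>q\<in>?I. sT (c q) (?e q))"
        by (rule sT.span_familyE[of ?I x ?e]) (use \<open>x \<in> T\<close> spanT in auto)
      show "(L ^^ ?N) x = 0"
        unfolding x
        by (subst sT.linear_on_sum[OF lin]) (use G.e_in_whole G.subspace_whole T vanish in \<open>auto simp del: funpow.simps\<close>)
    qed
  qed (fact L(1))
  define ps where "ps = map (\<lambda>k. (n + m + 1 - 2 * k, s + t + k - 1)) [1..<Suc m]"
  have ps_nth: "ps ! a = (G.string_length a, s + t + a)" if "a < m" for a
    using that by (simp add: ps_def G.string_length_def del: upt_Suc)
  have len: "length ps = m" by (simp add: ps_def)
  have idx: "sT.string_index ps = (SIGMA a:{..<m}. {..<G.string_length a})"
    unfolding sT.string_index_def len by (auto simp: ps_nth)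
  have "sT.string_basis T gr L ps G.prim"
    unfolding sT.string_basis_def idx sT.string_vector_def
  proof (intro conjI allI impI)
    fix a assume "a < length ps"
    then have a: "a < m" by (simp add: len)
    show "1 \<le> fst (ps ! a)" using a \<open>m \<le> n\<close> by (simp add: ps_nth G.string_length_def)
    show "G.prim a \<in> gr (snd (ps ! a))" using a G.prim_in_piece[of a] by (simp add: ps_nth gr_piece)
    show "(L ^^ fst (ps ! a)) (G.prim a) = 0" using a G.prim_string_ends by (simp add: ps_nth)
  qed (use G.indep_prim_strings G.span_prim_strings T in auto)
  then have "string_decomposition sT T gr L (mset ps)"
    by (rule sT.string_decomposition_of_basis[OF gn])
  moreover have "mset ps = {# (n + m + 1 - 2 * k, s + t + k - 1). k \<in># mset_set {1..m} #}"
    by (simp add: ps_def atLeastLessThanSuc_atLeastAtMost del: upt_Suc flip: mset_set_upto_eq_mset_upto)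
  ultimately show ?thesis
    using sT.jordan_degree_type_eqI unfolding Let_def gr_def by metis
qed

end
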